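(* Let $t\ge 1$ and $w_1,\ldots,w_t$ be fixed positive integers such that either $t\neq 2$ or $\min\{w_1,w_2\}\neq 1$, and put $u=\sum_{i=1}^t w_i$. Then, as $q\to\infty$, \[ q^{2-o(1)}< C\big(u,q,\{w_1,\ldots,w_t\}\big)=o(q^2). \] In particular, for every fixed $t\ge 3$, $q^{2-o(1)}<p_t(t,q)=o(q^2)$ as $q\to\infty$.
   Context: Let $X$ and $Y$ be sets with $|X|=n$ and $|Y|=q$. An $(N;n,q)$-hash family is a family $\mathcal F$ of $N$ functions from $X$ to $Y$. A function $f$ separates pairwise disjoint subsets $C_1,\ldots,C_t\subseteq X$ if the sets $f(C_1),\ldots,f(C_t)$ are pairwise disjoint. An $(N;n,q)$-hash family $\mathcal F$ is an $SHF(N;n,q,\{w_1,\ldots,w_t\})$ (separating hash family of type the multiset $\{w_1,\ldots,w_t\}$) if for all pairwise disjoint $C_1,\ldots,C_t\subseteq X$ with $|C_i|=w_i\ge 1$ there is some $f\in\mathcal F$ separating $C_1,\ldots,C_t$. $C(N,q,\{w_1,\ldots,w_t\})$ denotes the maximum $n$ for which an $SHF(N;n,q,\{w_1,\ldots,w_t\})$ exists. An $SHF(N;n,q,\{1,\ldots,1\})$ with $t$ ones is a $t$-perfect hash family, and $p_t(N,q):=C(N,q,\{1,\ldots,1\})$ ($t$ ones).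
   Formalization: The formal statement takes t ≥ 2 instead of t ≥ 1: for t = 1 separating a single set is no condition, so an SHF exists for every n, the maximum C(u,q,{w_1}) does not exist, and the claim C = o(q^2) fails. *)

theory Defs
  imports Complex_Main "HOL-Library.Multiset" "HOL-Library.Disjoint_Sets"
    "HOL-Library.FuncSet" "HOL-Library.Landau_Symbols"
begin

text \<open>A family of \<open>N\<close> functions is indexed by \<open>{..<N}\<close>; repetitions are allowed.\<close>

definition hash_family :: "nat \<Rightarrow> 'a set \<Rightarrow> 'b set \<Rightarrow> (nat \<Rightarrow> 'a \<Rightarrow> 'b) \<Rightarrow> bool" where
  "hash_family N X Y F \<longleftrightarrow> (\<forall>k<N. F k \<in> X \<rightarrow> Y)"

definition pairwise_disjoint_list :: "'a set list \<Rightarrow> bool" where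
  "pairwise_disjoint_list Cs \<longleftrightarrow> disjoint_family_on (\<lambda>i. Cs ! i) {..<length Cs}"

definition separates :: "('a \<Rightarrow> 'b) \<Rightarrow> 'a set list \<Rightarrow> bool" where
  "separates f Cs \<longleftrightarrow> pairwise_disjoint_list (map (image f) Cs)"

text \<open>The type \<open>W\<close> is a multiset: the sets to be separated form a list whose sizes,
  in any order, are the members of \<open>W\<close>.\<close>

definition separating_hash_family ::
    "nat \<Rightarrow> 'a set \<Rightarrow> 'b set \<Rightarrow> nat multiset \<Rightarrow> (nat \<Rightarrow> 'a \<Rightarrow> 'b) \<Rightarrow> bool" where
  "separating_hash_family N X Y W F \<longleftrightarrow>
     hash_family N X Y F \<and>
     (\<forall>Cs. (\<forall>C\<in>set Cs. C \<subseteq> X) \<longrightarrow> mset (map card Cs) = W \<longrightarrow> pairwise_disjoint_list Cs \<longrightarrow>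
        (\<exists>k<N. separates (F k) Cs))"

text \<open>Only the cardinalities of \<open>X\<close> and \<open>Y\<close> matter, so \<open>X = {..<n}\<close> and \<open>Y = {..<q}\<close>.\<close>

definition SHF_sizes :: "nat \<Rightarrow> nat \<Rightarrow> nat multiset \<Rightarrow> nat set" where
  "SHF_sizes N q W =
     {n. \<exists>F :: nat \<Rightarrow> nat \<Rightarrow> nat. separating_hash_family N {..<n} {..<q} W F}"

definition max_SHF :: "nat \<Rightarrow> nat \<Rightarrow> nat multiset \<Rightarrow> nat" where
  "max_SHF N q W = Max (SHF_sizes N q W)"

definition max_PHF :: "nat \<Rightarrow> nat \<Rightarrow> nat \<Rightarrow> nat" where
  "max_PHF t N q = max_SHF N q (replicate_mset t 1)"

text \<open>The maximum exists as soon as \<open>W\<close> has at least two members (and \<open>N \<ge> 1\<close>). It does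
  not exist when \<open>W\<close> has exactly one: separating a single set is no condition at all.\<close>

lemma SHF_sizes_singleton:
  assumes "N \<ge> 1" "q \<ge> 1"
  shows "SHF_sizes N q {#w#} = UNIV"
proof -
  have "separating_hash_family N {..<n} {..<q} {#w#} (\<lambda>_ _. 0::nat)" for n :: nat
    unfolding separating_hash_family_def hash_family_def
  proof (intro conjI allI impI)
    fix Cs :: "nat set list"
    assume "mset (map card Cs) = {#w#}"
    then have "length Cs = 1" by (metis length_map size_mset size_single)
    then have "separates (\<lambda>_. 0::nat) Cs"
      unfolding separates_def pairwise_disjoint_list_def disjoint_family_on_def by simp
    then show "\<exists>k<N. separates (\<lambda>_. 0::nat) Cs" using assms(1) by (intro exI[of _ 0]) auto
  qed (use assms in simp)
  then show ?thesis unfolding SHF_sizes_def by auto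
qed

lemma zero_in_SHF_sizes:
  assumes "N \<ge> 1"
  shows "0 \<in> SHF_sizes N q W"
proof -
  have empty: "separates f Cs" if "\<forall>C\<in>set Cs. C \<subseteq> {}" for f :: "nat \<Rightarrow> nat" and Cs
  proof -
    have "Cs ! i = {}" if "i < length Cs" for i
      using \<open>\<forall>C\<in>set Cs. C \<subseteq> {}\<close> nth_mem[OF that] by blast
    then show ?thesis
      unfolding separates_def pairwise_disjoint_list_def disjoint_family_on_def by simp
  qed
  have "separating_hash_family N {..<0::nat} {..<q} W (\<lambda>_ _. 0::nat)"
    unfolding separating_hash_family_def hash_family_def
  proof (intro conjI allI impI)
    fix Cs :: "nat set list"
    assume "\<forall>C\<in>set Cs. C \<subseteq> {..<0::nat}"
    then have "separates (\<lambda>_. 0::nat) Cs" using empty by simp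
    then show "\<exists>k<N. separates (\<lambda>_. 0::nat) Cs" using assms(1) by (intro exI[of _ 0]) auto
  qed simp
  then show ?thesis unfolding SHF_sizes_def by blast
qed

lemma ex_disjoint_sets_with_cards:
  assumes "finite A" "sum_list ws \<le> card A"
  shows "\<exists>Cs. (\<forall>C\<in>set Cs. C \<subseteq> A) \<and> map card Cs = ws \<and> pairwise_disjoint_list Cs"
  using assms
proof (induction ws arbitrary: A)
  case Nil
  then show ?case by (auto simp: pairwise_disjoint_list_def disjoint_family_on_def)
next
  case (Cons w ws)
  obtain B where B: "B \<subseteq> A" "card B = w"
    using Cons.prems obtain_subset_with_card_n[of w A] by auto
  have "sum_list ws \<le> card (A - B)"
    using Cons.prems B by (simp add: card_Diff_subset finite_subset)
  with Cons.IH[of "A - B"] Cons.prems(1) obtain Cs where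
    Cs: "\<forall>C\<in>set Cs. C \<subseteq> A - B" "map card Cs = ws" "pairwise_disjoint_list Cs"
    by auto
  have "pairwise_disjoint_list (B # Cs)"
    unfolding pairwise_disjoint_list_def disjoint_family_on_def
  proof (intro ballI impI)
    fix i j assume ij: "i \<in> {..<length (B # Cs)}" "j \<in> {..<length (B # Cs)}" "i \<noteq> j"
    have sep: "Cs ! k \<inter> B = {}" if "k < length Cs" for k
      using Cs(1) nth_mem[OF that] by blast
    show "(B # Cs) ! i \<inter> (B # Cs) ! j = {}"
      using ij sep Cs(3) unfolding pairwise_disjoint_list_def disjoint_family_on_def
      by (cases i; cases j) (auto simp: Int_commute)
  qed
  moreover have "\<forall>C\<in>set (B # Cs). C \<subseteq> A" using Cs(1) B(1) by auto
  moreover have "map card (B # Cs) = w # ws" using Cs(2) B(2) by simp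
  ultimately show ?case by (intro exI[of _ "B # Cs"] conjI)
qed

lemma finite_SHF_sizes:
  assumes two: "size W \<ge> 2" and pos: "\<forall>w\<in>#W. w \<ge> 1"
  shows "finite (SHF_sizes N q W)"
proof (rule finite_subset)
  show "SHF_sizes N q W \<subseteq> {..sum_mset W + q ^ N}"
  proof
    obtain ws where ws: "mset ws = W" using ex_mset by blast
    obtain a b rest where abr: "ws = a # b # rest"
      using two ws by (cases ws; cases "tl ws") auto
    have ab: "a \<ge> 1" "b \<ge> 1" using pos ws abr by auto
    have sum_ws: "sum_mset W = sum_list ws" using ws sum_mset_sum_list by blast
    fix n assume "n \<in> SHF_sizes N q W"
    then obtain F :: "nat \<Rightarrow> nat \<Rightarrow> nat" where F: "separating_hash_family N {..<n} {..<q} W F"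
      unfolding SHF_sizes_def by blast
    show "n \<in> {..sum_mset W + q ^ N}"
    proof (rule ccontr)
      assume "n \<notin> {..sum_mset W + q ^ N}"
      then have n: "n > sum_list ws" "n > q ^ N" by (auto simp: sum_ws)
      let ?h = "\<lambda>x. restrict (\<lambda>k. F k x) {..<N}"
      have "F k x \<in> {..<q}" if "k < N" "x < n" for k x
        using F that unfolding separating_hash_family_def hash_family_def Pi_def by blast
      then have "?h ` {..<n} \<subseteq> {..<N} \<rightarrow>\<^sub>E {..<q}"
        by (intro image_subsetI PiE_I) simp_all
      moreover have "finite ({..<N} \<rightarrow>\<^sub>E {..<q})" by (intro finite_PiE) auto
      ultimately have "card (?h ` {..<n}) \<le> card ({..<N} \<rightarrow>\<^sub>E {..<q})"
        by (rule card_mono[rotated])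
      also have "\<dots> = q ^ N" by (simp add: card_PiE)
      finally have "card (?h ` {..<n}) < card {..<n}" using n by simp
      then have "\<not> inj_on ?h {..<n}" by (rule pigeonhole)
      then obtain x y where xy: "x < n" "y < n" "x \<noteq> y" "?h x = ?h y"
        by (auto simp: inj_on_def)
      have coll: "F k x = F k y" if "k < N" for k
        using fun_cong[OF xy(4), of k] that by simp
      let ?A = "{..<n} - {x, y}"
      have "sum_list ((a - 1) # (b - 1) # rest) \<le> card ?A"
        using n ab abr xy by (simp add: card_Diff_subset)
      from ex_disjoint_sets_with_cards[OF _ this]
      obtain Cs where Cs: "\<forall>C\<in>set Cs. C \<subseteq> ?A"
          "map card Cs = (a - 1) # (b - 1) # rest" "pairwise_disjoint_list Cs"
        by (metis finite_Diff finite_lessThan)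
      from Cs(2) obtain P Q R where PQR: "Cs = P # Q # R" "card P = a - 1" "card Q = b - 1"
          "map card R = rest"
        unfolding map_eq_Cons_conv by blast
      let ?D = "insert x P # insert y Q # R"
      have sub: "P \<subseteq> ?A" "Q \<subseteq> ?A" "\<forall>C\<in>set R. C \<subseteq> ?A" using Cs(1) PQR by auto
      have fin: "finite P" "finite Q" using sub(1,2) finite_subset by blast+
      have "mset (map card ?D) = W"
      proof -
        have "x \<notin> P" "y \<notin> Q" using sub by auto
        then have "card (insert x P) = a" "card (insert y Q) = b"
          using fin PQR(2,3) ab by simp_all
        then show ?thesis using PQR(4) ws abr by simp
      qed
      moreover have "\<forall>C\<in>set ?D. C \<subseteq> {..<n}" using sub xy by auto
      moreover have "pairwise_disjoint_list ?D"
        unfolding pairwise_disjoint_list_def disjoint_family_on_def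
      proof (intro ballI impI)
        fix i j assume ij: "i \<in> {..<length ?D}" "j \<in> {..<length ?D}" "i \<noteq> j"
        have D: "?D ! k = Cs ! k \<union> (if k = 0 then {x} else if k = 1 then {y} else {})" for k
          using PQR(1) by (cases k; cases "k - 1") auto
        have nxy: "x \<notin> Cs ! k" "y \<notin> Cs ! k" if "k < length Cs" for k
          using Cs(1) nth_mem[OF that] by blast+
        have "Cs ! i \<inter> Cs ! j = {}"
          using Cs(3) ij PQR(1) unfolding pairwise_disjoint_list_def disjoint_family_on_def
          by simp
        then show "?D ! i \<inter> ?D ! j = {}"
          unfolding D using ij nxy[of i] nxy[of j] PQR(1) xy(3) by auto
      qed
      ultimately obtain k where k: "k < N" "separates (F k) ?D"
        using F unfolding separating_hash_family_def by blast
      have "F k ` insert x P \<inter> F k ` insert y Q = {}"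
        using disjoint_family_onD[OF k(2)[unfolded separates_def pairwise_disjoint_list_def], of 0 1]
        by simp
      with coll[OF k(1)] show False by auto
    qed
  qed
qed simp

end

theory Submission
  imports Defs "HOL-Real_Asymp.Real_Asymp"
begin

text \<open>
  \<^bold>\<open>Rainbow cycles.\<close> Let each \<open>F k\<close> contribute an edge of colour \<open>k\<close> between any two elements on which it
  agrees. If none of the \<open>u\<close> functions separates some sets with \<open>u\<close> elements altogether, these elements
  carry an edge of each of the \<open>u\<close> colours, hence a cycle with distinct colours. Conversely, after
  deleting the elements in small fibres, a rainbow cycle placed suitably in the sets \<open>C\<^sub>1, \<dots>, C\<^sub>t\<close> extends
  greedily, one element and one colour at a time, to sets that no function separates.

  \<^bold>\<open>Lower bound.\<close> Take pairs \<open>(p, r)\<close> of vectors of polynomials in \<open>T\<^sub>0, \<dots>, T\<^sub>u\<^sub>-\<^sub>1\<close> with small coefficients,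
  and \<open>F k (p, r) = p + T\<^sub>k r\<close>. Around a rainbow cycle the values \<open>r\<^sub>i\<close> satisfy a linear equation with
  coefficients \<open>T\<^sub>k - T\<^sub>k\<^sub>'\<close>; at a point where the \<open>T\<^sub>k\<close> increase along the cycle it exhibits one \<open>r\<^sub>i\<close> as a convex
  combination of the others. As in Behrend's construction, all \<open>r\<close> are chosen with the same Euclidean
  norm, now at one point for each ordering of the variables, so that all \<open>r\<^sub>i\<close> coincide. The use of
  several variables makes every ordering available.

  \<^bold>\<open>Upper bound.\<close> If two elements agree twice they form a rainbow cycle of length 2. Otherwise
  the graphs formed by the pairs \<open>(F k x, F (k + 1) x)\<close> are regularised by energy increments, and a dense
  regular triangle or quadrilateral of cells yields a rainbow cycle of length 3 (if \<open>t \<ge> 3\<close>) or 4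
  (if \<open>t = 2\<close>), since the degenerate cycles are too few.
\<close>

section \<open>Rainbow cycles\<close>

text \<open>Induction on the number of vertices. A vertex on at most one edge is deleted together
  with that edge, which keeps at least as many edges as vertices. If there is none, every path can
  be continued along an edge other than its last and finally runs into itself. Parallel edges give
  cycles of length 2.\<close>

lemma edges_contain_cycle:
  fixes E :: "'e \<Rightarrow> 'a set"
  assumes "finite V" "finite K" "K \<noteq> {}" "card V \<le> card K"
    and "\<And>k. k \<in> K \<Longrightarrow> E k \<subseteq> V \<and> card (E k) = 2"
  shows "\<exists>l v e. 2 \<le> l \<and> inj_on v {..<l} \<and> v ` {..<l} \<subseteq> V \<and> inj_on e {..<l} \<and> e ` {..<l} \<subseteq> K \<and>
           (\<forall>i<l. E (e i) = {v i, v (Suc i mod l)})"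
  using assms
proof (induction "card V" arbitrary: V K rule: less_induct)
  case less
  show ?case
  proof (cases "\<exists>a\<in>V. \<exists>k. \<forall>k'\<in>K. k' \<noteq> k \<longrightarrow> a \<notin> E k'")
    case True
    then obtain a k where a: "a \<in> V" "\<forall>k'\<in>K. k' \<noteq> k \<longrightarrow> a \<notin> E k'" by blast
    have c: "card (V - {a}) < card V" using a less.prems(1) by (meson card_Diff1_less)
    have "card (V - {a}) \<le> card (K - {k})"
      using less.prems(1,2,4) a(1) by (cases "k \<in> K") (auto simp: card_Diff_singleton)
    moreover have "K - {k} \<noteq> {}"
    proof
      assume "K - {k} = {}"
      with less.prems(3) have K: "K = {k}" by blast
      then have "2 \<le> card V"
        using less.prems(5)[of k] card_mono[OF less.prems(1), of "E k"] by simp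
      with less.prems(4) K show False by simp
    qed
    moreover have "E k' \<subseteq> V - {a} \<and> card (E k') = 2" if "k' \<in> K - {k}" for k'
      using that a(2) less.prems(5)[of k'] by blast
    ultimately obtain l v e where
      "2 \<le> l" "inj_on v {..<l}" "v ` {..<l} \<subseteq> V - {a}" "inj_on e {..<l}" "e ` {..<l} \<subseteq> K - {k}"
      "\<forall>i<l. E (e i) = {v i, v (Suc i mod l)}"
      using less.hyps[OF c, of "K - {k}"] less.prems(1,2) by (metis finite_Diff)
    then show ?thesis by blast
  next
    case False
    then have deg: "\<exists>k'\<in>K. k' \<noteq> k \<and> a \<in> E k'" if "a \<in> V" for a k using that by blast
    have "V \<noteq> {}" using less.prems(3,5) by force
    \<comment> \<open>Either a path with \<open>n\<close> edges exists or the cycle is found; for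
      \<open>n = card V\<close> the path would have too many vertices.\<close>
    have path: "(\<exists>v e. inj_on v {..n} \<and> v ` {..n} \<subseteq> V \<and> inj_on e {..<n} \<and> e ` {..<n} \<subseteq> K \<and>
                 (\<forall>i<n. E (e i) = {v i, v (Suc i)})) \<or> ?thesis" for n
    proof (induction n)
      case 0
      obtain a where "a \<in> V" using \<open>V \<noteq> {}\<close> by blast
      then show ?case by (intro disjI1 exI[of _ "\<lambda>_. a"]) auto
    next
      case (Suc n)
      show ?case
      proof (cases ?thesis)
        case False
        with Suc obtain v e where ve: "inj_on v {..n}" "v ` {..n} \<subseteq> V" "inj_on e {..<n}"
          "e ` {..<n} \<subseteq> K" "\<forall>i<n. E (e i) = {v i, v (Suc i)}" by blast
        \<comment> \<open>For \<open>n = 0\<close> no edge has been used yet, and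
          \<open>e (n - 1)\<close> is an arbitrary colour, which is harmless.\<close>
        obtain k where k: "k \<in> K" "k \<noteq> e (n - 1)" "v n \<in> E k"
          using deg[of "v n" "e (n - 1)"] ve(2) by blast
        then obtain w where w: "E k = {v n, w}" "w \<noteq> v n" "w \<in> V"
          using less.prems(5)[OF k(1)] by (fastforce simp: card_2_iff insert_commute)
        have knew: "k \<notin> e ` {..<n}"
        proof
          assume "k \<in> e ` {..<n}"
          then obtain i where i: "i < n" "k = e i" by auto
          then have "v n = v i \<or> v n = v (Suc i)" using ve(5) k(3) by auto
          then have "Suc i = n" using ve(1) i(1) by (auto dest: inj_onD)
          then show False using i k(2) by auto
        qed
        show ?thesis
        proof (cases "w \<in> v ` {..n}")
          case False
          have "inj_on (v(Suc n := w)) {..Suc n}"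
            using ve(1) False by (auto simp: inj_on_def atMost_Suc)
          moreover have "inj_on (e(n := k)) {..<Suc n}"
            using ve(3) knew by (auto simp: inj_on_def lessThan_Suc)
          moreover have "E ((e(n := k)) i) = {(v(Suc n := w)) i, (v(Suc n := w)) (Suc i)}"
            if "i < Suc n" for i
            using that ve(5) w(1) by (cases "i = n") auto
          moreover have "(v(Suc n := w)) ` {..Suc n} \<subseteq> V" "(e(n := k)) ` {..<Suc n} \<subseteq> K"
            using ve(2,4) w(3) k(1) by auto
          ultimately show ?thesis by blast
        next
          case True
          then obtain j where j: "j < n" "w = v j"
            using w(2) by (metis atMost_iff imageE le_neq_implies_less)
          \<comment> \<open>The new edge returns to \<open>v j\<close>, so the cycle is
            \<open>v j, ..., v n\<close> closed by \<open>k\<close>; for \<open>j = n - 1\<close>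
            the edges \<open>e j\<close> and \<open>k\<close> are parallel.\<close>
          define l where "l = Suc (n - j)"
          define v' where "v' i = v (j + i)" for i
          define e' where "e' i = (if i < n - j then e (j + i) else k)" for i
          have "2 \<le> l" using j by (simp add: l_def)
          moreover have "inj_on v' {..<l}"
          proof (rule inj_onI)
            fix a b assume ab: "a \<in> {..<l}" "b \<in> {..<l}" "v' a = v' b"
            then have "j + a \<le> n" "j + b \<le> n" using j(1) by (auto simp: l_def)
            with ve(1) ab(3) show "a = b" by (auto simp: v'_def dest: inj_onD)
          qed
          moreover have "v' ` {..<l} \<subseteq> V" using ve(2) j(1) by (auto simp: v'_def l_def)
          moreover have "inj_on e' {..<l}"
          proof (rule inj_onI)
            fix a b assume "a \<in> {..<l}" "b \<in> {..<l}" and eq: "e' a = e' b"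
            then have ab: "a \<le> n - j" "b \<le> n - j" by (auto simp: l_def)
            have ke: "e (j + i) \<noteq> k" if "i < n - j" for i using that knew by auto
            show "a = b"
            proof (cases "a < n - j \<and> b < n - j")
              case True
              then have "j + a < n" "j + b < n" "e (j + a) = e (j + b)" using eq by (auto simp: e'_def)
              then have "j + a = j + b" by (intro inj_onD[OF ve(3)]) simp_all
              then show ?thesis by simp
            next
              case False
              with eq ab ke[of a] ke[of b] show ?thesis
                by (cases "a < n - j"; cases "b < n - j") (auto simp: e'_def)
            qed
          qed
          moreover have "e' ` {..<l} \<subseteq> K" using ve(4) k(1) by (auto simp: e'_def)
          moreover have "E (e' i) = {v' i, v' (Suc i mod l)}" if "i < l" for i
          proof (cases "i < n - j")
            case True
            then show ?thesis using ve(5) by (simp add: e'_def v'_def l_def)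
          next
            case False
            with that have "i = n - j" by (simp add: l_def)
            then show ?thesis using w(1) j by (simp add: e'_def v'_def l_def)
          qed
          ultimately show ?thesis by blast
        qed
      qed simp
    qed
    show ?thesis
    proof (rule ccontr)
      assume "\<not> ?thesis"
      with path[of "card V"] obtain v :: "nat \<Rightarrow> 'a" where v: "inj_on v {..card V}" "v ` {..card V} \<subseteq> V"
        by blast
      have "card {..card V} \<le> card V" by (rule card_inj_on_le[OF v less.prems(1)])
      then show False by simp
    qed
  qed
qed

text \<open>Length 2 is included: two distinct elements that agree under two different
  functions.\<close>

definition rainbow_cycle ::
    "nat \<Rightarrow> 'a set \<Rightarrow> (nat \<Rightarrow> 'a \<Rightarrow> 'b) \<Rightarrow> nat \<Rightarrow> (nat \<Rightarrow> 'a) \<Rightarrow> (nat \<Rightarrow> nat) \<Rightarrow> bool" where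
  "rainbow_cycle N X F l v k \<longleftrightarrow>
     2 \<le> l \<and> inj_on v {..<l} \<and> v ` {..<l} \<subseteq> X \<and> inj_on k {..<l} \<and> k ` {..<l} \<subseteq> {..<N} \<and>
     (\<forall>i<l. F (k i) (v i) = F (k i) (v (Suc i mod l)))"

text \<open>A function that fails to separate supplies an edge of its colour inside the union of the
  sets. This union has at most \<open>N\<close> elements and carries \<open>N\<close> edges, so
  \<open>edges_contain_cycle\<close> applies.\<close>

lemma separating_if_no_rainbow_cycle:
  fixes F :: "nat \<Rightarrow> 'a \<Rightarrow> 'b"
  assumes fam: "hash_family N X Y F" and N: "sum_mset W \<le> N" "N \<ge> 1" and fin: "finite X"
    and no: "\<And>l v k. \<not> rainbow_cycle N X F l v k"
  shows "separating_hash_family N X Y W F"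
  unfolding separating_hash_family_def
proof (intro conjI allI impI fam)
  fix Cs :: "'a set list"
  assume Cs: "\<forall>C\<in>set Cs. C \<subseteq> X" "mset (map card Cs) = W" "pairwise_disjoint_list Cs"
  show "\<exists>k<N. separates (F k) Cs"
  proof (rule ccontr)
    assume "\<not> ?thesis"
    then have non: "\<not> separates (F k) Cs" if "k < N" for k using that by blast
    have "\<exists>x y. x \<in> \<Union> (set Cs) \<and> y \<in> \<Union> (set Cs) \<and> x \<noteq> y \<and> F k x = F k y" if k: "k < N" for k
    proof -
      obtain i j where ij: "i < length Cs" "j < length Cs" "i \<noteq> j"
        "F k ` (Cs ! i) \<inter> F k ` (Cs ! j) \<noteq> {}"
        using non[OF k]
        unfolding separates_def pairwise_disjoint_list_def disjoint_family_on_def by auto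
      then obtain x y where "x \<in> Cs ! i" "y \<in> Cs ! j" "F k x = F k y" by blast
      moreover have "Cs ! i \<inter> Cs ! j = {}"
        using Cs(3) ij unfolding pairwise_disjoint_list_def disjoint_family_on_def by simp
      ultimately show ?thesis using ij(1,2) nth_mem by blast
    qed
    then obtain x y where xy: "\<And>k. k < N \<Longrightarrow> x k \<in> \<Union> (set Cs) \<and> y k \<in> \<Union> (set Cs) \<and>
        x k \<noteq> y k \<and> F k (x k) = F k (y k)" by metis
    have fU: "finite (\<Union> (set Cs))" using Cs(1) fin finite_subset by (metis Union_least)
    have "card (\<Union> (set Cs)) \<le> sum_list (map card Cs)"
    proof (induction Cs)
      case (Cons C Cs)
      have "card (\<Union> (set (C # Cs))) \<le> card C + card (\<Union> (set Cs))"
        by (simp add: card_Un_le)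
      with Cons show ?case by simp
    qed simp
    then have c1: "card (\<Union> (set Cs)) \<le> card {..<N}"
      using N(1) Cs(2) by (metis card_lessThan order.trans sum_mset_sum_list)
    have c2: "{..<N} \<noteq> {}" using N(2) by (simp add: lessThan_empty_iff)
    have c3: "{x k, y k} \<subseteq> \<Union> (set Cs) \<and> card {x k, y k} = 2" if "k \<in> {..<N}" for k
      using xy[of k] that by simp
    obtain l v e where c: "2 \<le> l" "inj_on v {..<l}" "v ` {..<l} \<subseteq> \<Union> (set Cs)"
      "inj_on e {..<l}" "e ` {..<l} \<subseteq> {..<N}" "\<forall>i<l. {x (e i), y (e i)} = {v i, v (Suc i mod l)}"
      by (atomize_elim, rule edges_contain_cycle[where E = "\<lambda>k. {x k, y k}",
            OF fU finite_lessThan c2 c1 c3])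
    have "F (e i) (v i) = F (e i) (v (Suc i mod l))" if "i < l" for i
    proof -
      have "e i < N" using that c(5) by auto
      then show ?thesis using c(6) that xy[of "e i"] by (metis doubleton_eq_iff)
    qed
    moreover have "v ` {..<l} \<subseteq> X" using c(3) Cs(1) by blast
    ultimately have "rainbow_cycle N X F l v e" unfolding rainbow_cycle_def using c by simp
    with no show False by blast
  qed
qed

text \<open>Renames domain and range to the initial segments used in \<open>SHF_sizes\<close>; a
  bijection on the domain and an injection on the range create no new agreements.\<close>

lemma SHF_sizes_if_no_rainbow_cycle:
  fixes F :: "nat \<Rightarrow> 'a \<Rightarrow> 'b"
  assumes X: "finite X" "card X = n" and Y: "finite Y" "card Y \<le> q"
    and F: "hash_family N X Y F" and N: "sum_mset W \<le> N" "N \<ge> 1"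
    and no: "\<And>l v k. \<not> rainbow_cycle N X F l v k"
  shows "n \<in> SHF_sizes N q W"
proof -
  obtain f where f: "bij_betw f {..<n} X" using X ex_bij_betw_nat_finite[of X]
    by (auto simp: atLeast0LessThan)
  obtain g where g: "g ` Y \<subseteq> {..<q}" "inj_on g Y"
    using card_le_inj[of Y "{..<q}"] Y by auto
  define F' where "F' k i = g (F k (f i))" for k i
  have mem: "F k (f i) \<in> Y" if "k < N" "i < n" for k i
    using that F f unfolding hash_family_def bij_betw_def by (blast intro: PiE)
  have "hash_family N {..<n} {..<q} F'"
    unfolding hash_family_def F'_def using mem g(1) by blast
  moreover have "\<not> rainbow_cycle N {..<n} F' l v k" for l v k
  proof
    assume "rainbow_cycle N {..<n} F' l v k"
    then have c: "2 \<le> l" "inj_on v {..<l}" "v ` {..<l} \<subseteq> {..<n}" "inj_on k {..<l}" "k ` {..<l} \<subseteq> {..<N}"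
      "\<And>i. i < l \<Longrightarrow> F' (k i) (v i) = F' (k i) (v (Suc i mod l))"
      unfolding rainbow_cycle_def by auto
    have "inj_on (f \<circ> v) {..<l}"
      using c(2,3) f by (meson bij_betw_def comp_inj_on inj_on_subset)
    moreover have "(f \<circ> v) ` {..<l} \<subseteq> X" using c(3) f unfolding bij_betw_def by auto
    moreover have "F (k i) ((f \<circ> v) i) = F (k i) ((f \<circ> v) (Suc i mod l))" if "i < l" for i
    proof -
      have "Suc i mod l < l" using c(1) by simp
      then have "k i < N" "v i < n" "v (Suc i mod l) < n" using c(3,5) that by blast+
      then show ?thesis
        using c(6)[OF that] mem g(2) by (auto simp: F'_def dest: inj_onD)
    qed
    ultimately have "rainbow_cycle N X F l (f \<circ> v) k"
      unfolding rainbow_cycle_def using c by simp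
    with no show False by blast
  qed
  ultimately have "separating_hash_family N {..<n} {..<q} W F'"
    by (intro separating_if_no_rainbow_cycle N) auto
  then show ?thesis unfolding SHF_sizes_def by blast
qed

section \<open>Polynomials avoiding rainbow cycles\<close>

text \<open>At the lowest position where the digits differ, their difference must be divisible by
  \<open>B\<close>, because all other differing positions contribute multiples of a higher power;
  being smaller than \<open>B\<close> in absolute value, it vanishes. The positions
  \<open>c a\<close> are arbitrary distinct exponents.\<close>

lemma base_digits_unique:
  fixes x y c :: "'a \<Rightarrow> nat"
  assumes fin: "finite A" and inj: "inj_on c A"
    and dig: "\<And>a. a \<in> A \<Longrightarrow> x a < B \<and> y a < B"
    and eq: "(\<Sum>a\<in>A. B ^ c a * x a) = (\<Sum>a\<in>A. B ^ c a * y a)"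
  shows "\<forall>a\<in>A. x a = y a"
proof (rule ccontr)
  define z where "z a = int (x a) - int (y a)" for a
  define D where "D = {a\<in>A. z a \<noteq> 0}"
  assume "\<not> ?thesis"
  then have "D \<noteq> {}" "finite D" using fin by (auto simp: D_def z_def)
  then obtain a where a: "a \<in> D" "\<forall>b\<in>D. c a \<le> c b"
    by (metis (mono_tags, lifting) arg_min_if_finite(1) arg_min_least)
  have B: "B > 0" using dig[of a] a(1) by (auto simp: D_def)
  have "int (\<Sum>a\<in>A. B ^ c a * x a) - int (\<Sum>a\<in>A. B ^ c a * y a) = 0" using eq by simp
  then have "(\<Sum>a\<in>A. int B ^ c a * z a) = 0"
    by (simp add: z_def sum_subtractf right_diff_distrib)
  also have "(\<Sum>a\<in>A. int B ^ c a * z a) = (\<Sum>a\<in>D. int B ^ c a * z a)"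
    by (rule sum.mono_neutral_right) (auto simp: D_def fin)
  also have "\<dots> = int B ^ c a * z a + (\<Sum>b\<in>D - {a}. int B ^ c b * z b)"
    using a(1) \<open>finite D\<close> by (simp add: sum.remove)
  finally have s: "int B ^ c a * z a = - (\<Sum>b\<in>D - {a}. int B ^ c b * z b)" by simp
  have "int B ^ Suc (c a) dvd int B ^ c b * z b" if "b \<in> D - {a}" for b
  proof -
    have "c a \<noteq> c b" using that a(1) inj by (auto simp: D_def dest: inj_onD)
    then have "Suc (c a) \<le> c b" using a(2) that by (metis DiffD1 le_neq_implies_less Suc_leI)
    then show ?thesis by (intro dvd_mult2 le_imp_power_dvd)
  qed
  then have "int B ^ Suc (c a) dvd int B ^ c a * z a"
    unfolding s dvd_minus_iff by (rule dvd_sum)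
  then have "int B dvd z a" using B by (simp add: mult.commute)
  moreover have "\<bar>z a\<bar> < int B" using dig[of a] a(1) by (auto simp: D_def z_def)
  moreover have "z a \<noteq> 0" using a(1) by (simp add: D_def)
  ultimately show False using dvd_imp_le_int[of "z a" "int B"] by simp
qed

text \<open>Summation by parts turns the cycle equation into the statement that \<open>s 0\<close> is a convex
  combination of the other \<open>s i\<close>, which all have the same norm.\<close>

lemma cyclic_convex_trivial:
  fixes t :: "nat \<Rightarrow> real" and s :: "nat \<Rightarrow> 'j \<Rightarrow> real"
  assumes t: "\<And>i i'. i < i' \<Longrightarrow> i' < l \<Longrightarrow> t i < t i'"
    and closed: "s l = s 0"
    and eq: "\<And>j. j \<in> J \<Longrightarrow> (\<Sum>i<l. t i * (s (Suc i) j - s i j)) = 0"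
    and norm: "\<And>i. i \<le> l \<Longrightarrow> (\<Sum>j\<in>J. (s i j)\<^sup>2) = M"
    and J: "finite J" and i: "i < l"
  shows "\<forall>j\<in>J. s i j = s 0 j"
proof -
  define b where "b i = (\<Sum>j\<in>J. (s i j - s 0 j)\<^sup>2)" for i
  \<comment> \<open>As all norms equal \<open>M\<close>, the squared distance \<open>b i\<close> is
    an affine function of \<open>s i\<close>, so \<open>b\<close> satisfies the same linear equation
    as \<open>s\<close>.\<close>
  have b: "b i = 2 * M - 2 * (\<Sum>j\<in>J. s i j * s 0 j)" if "i \<le> l" for i
    using norm[OF that] norm[of 0]
    by (simp add: b_def power2_diff sum.distrib sum_subtractf sum_distrib_left mult.assoc)
  have "b 0 = 0" "b l = 0" by (simp_all add: b_def closed)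
  have b0: "0 \<le> b i" for i by (simp add: b_def sum_nonneg)
  have parts: "(\<Sum>i<Suc n. t i * (b (Suc i) - b i)) =
      t n * b (Suc n) - t 0 * b 0 - (\<Sum>i<n. (t (Suc i) - t i) * b (Suc i))" for n
    by (induction n) (auto simp: algebra_simps)
  have "(\<Sum>i<l. t i * (b (Suc i) - b i)) = (\<Sum>i<l. \<Sum>j\<in>J. -2 * s 0 j * (t i * (s (Suc i) j - s i j)))"
    by (intro sum.cong refl)
      (simp add: b sum_distrib_left sum_subtractf[symmetric] algebra_simps)
  also have "\<dots> = (\<Sum>j\<in>J. -2 * s 0 j * (\<Sum>i<l. t i * (s (Suc i) j - s i j)))"
    by (subst sum.swap) (simp add: sum_distrib_left)
  also have "\<dots> = 0" using eq by simp
  finally have z: "(\<Sum>i<l. t i * (b (Suc i) - b i)) = 0" .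
  obtain n where n: "l = Suc n" using i by (cases l) auto
  \<comment> \<open>The boundary terms of the summation by parts vanish; what remains is a sum of
    nonnegative terms with positive weights, so every \<open>b i\<close> is zero.\<close>
  have "(\<Sum>i<n. (t (Suc i) - t i) * b (Suc i)) = 0"
    using z parts[of n] \<open>b 0 = 0\<close> \<open>b l = 0\<close> n by simp
  moreover have "0 < t (Suc i) - t i" if "i < n" for i using t[of i "Suc i"] that n by simp
  ultimately have "\<forall>i<n. (t (Suc i) - t i) * b (Suc i) = 0"
    using b0 by (subst (asm) sum_nonneg_eq_0_iff) (auto simp: less_imp_le)
  with \<open>\<And>i. i < n \<Longrightarrow> 0 < t (Suc i) - t i\<close> have "b (Suc i) = 0" if "i < n" for i
    using that by fastforce
  then have "b i = 0" using \<open>b 0 = 0\<close> i n by (cases i) auto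
  then show ?thesis using J by (simp add: b_def sum_nonneg_eq_0_iff)
qed

section \<open>Polynomials in several variables and their evaluation\<close>

definition expos :: "nat \<Rightarrow> nat \<Rightarrow> (nat \<Rightarrow> nat) set" where
  "expos u L = {..<u} \<rightarrow>\<^sub>E {..<L}"

lemma finite_expos [simp]: "finite (expos u L)"
  unfolding expos_def by (intro finite_PiE) auto

lemma card_expos [simp]: "card (expos u L) = L ^ u"
  unfolding expos_def by (simp add: card_PiE)

text \<open>Kronecker substitution: putting \<open>d ^ (Suc L ^ \<sigma> k)\<close> for the
  \<open>k\<close>-th variable turns the monomial with exponents \<open>\<gamma>\<close> into
  \<open>d ^ code u L \<sigma> \<gamma>\<close>. The base \<open>Suc L\<close> leaves room for all
  exponents up to \<open>L\<close>.\<close>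

definition code :: "nat \<Rightarrow> nat \<Rightarrow> (nat \<Rightarrow> nat) \<Rightarrow> (nat \<Rightarrow> nat) \<Rightarrow> nat" where
  "code u L \<sigma> \<gamma> = (\<Sum>k<u. Suc L ^ \<sigma> k * \<gamma> k)"

lemma inj_on_code:
  assumes "inj_on \<sigma> {..<u}"
  shows "inj_on (code u L \<sigma>) (expos u L)"
proof (rule inj_onI)
  fix \<beta> \<gamma> assume *: "\<beta> \<in> expos u L" "\<gamma> \<in> expos u L" "code u L \<sigma> \<beta> = code u L \<sigma> \<gamma>"
  have "\<forall>k\<in>{..<u}. \<beta> k = \<gamma> k"
  proof (rule base_digits_unique)
    show "\<beta> k < Suc L \<and> \<gamma> k < Suc L" if "k \<in> {..<u}" for k
      using * that PiE_mem[of _ "{..<u}" "\<lambda>_. {..<L}" k] unfolding expos_def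
      by (metis lessThan_iff less_SucI)
  qed (use * assms in \<open>auto simp: code_def\<close>)
  then show "\<beta> = \<gamma>" using *(1,2) unfolding expos_def by (intro PiE_ext) auto
qed

lemma code_Suc:
  assumes "k < u"
  shows "code u L \<sigma> (\<beta>(k := Suc (\<beta> k))) = Suc L ^ \<sigma> k + code u L \<sigma> \<beta>"
proof -
  have "(\<Sum>i\<in>{..<u} - {k}. Suc L ^ \<sigma> i * (\<beta>(k := Suc (\<beta> k))) i) = (\<Sum>i\<in>{..<u} - {k}. Suc L ^ \<sigma> i * \<beta> i)"
    by (intro sum.cong) auto
  then show ?thesis
    unfolding code_def using assms by (simp add: sum.remove[of "{..<u}" k])
qed

text \<open>An array \<open>p\<close> indexed by \<open>{..<m} \<times> expos u (Suc L)\<close> stands for a vector of \<open>m\<close> polynomials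
  in \<open>u\<close> variables \<open>T\<^sub>0, \<dots>, T\<^sub>u\<^sub>-\<^sub>1\<close>, of degree at most \<open>L\<close> in each of them, and \<open>r\<close> similarly for degree
  less than \<open>L\<close>. The \<open>k\<close>-th function is \<open>(p, r) \<mapsto> p + T\<^sub>k r\<close>.\<close>

definition shift :: "nat \<Rightarrow> nat \<Rightarrow> nat \<Rightarrow> (nat \<times> (nat \<Rightarrow> nat) \<Rightarrow> nat) \<Rightarrow> nat \<Rightarrow> (nat \<Rightarrow> nat) \<Rightarrow> nat" where
  "shift u L k r j \<gamma> =
     (if 0 < \<gamma> k \<and> \<gamma>(k := \<gamma> k - 1) \<in> expos u L then r (j, \<gamma>(k := \<gamma> k - 1)) else 0)"

definition poly_hash ::
    "nat \<Rightarrow> nat \<Rightarrow> nat \<Rightarrow> nat \<Rightarrow> (nat \<times> (nat \<Rightarrow> nat) \<Rightarrow> nat) \<times> (nat \<times> (nat \<Rightarrow> nat) \<Rightarrow> nat) \<Rightarrow>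
     nat \<times> (nat \<Rightarrow> nat) \<Rightarrow> nat" where
  "poly_hash u L m k x = (\<lambda>(j, \<gamma>)\<in>{..<m} \<times> expos u (Suc L). fst x (j, \<gamma>) + shift u L k (snd x) j \<gamma>)"

text \<open>Evaluation of the \<open>j\<close>-th polynomial at \<open>T\<^sub>k = d ^ (Suc L ^ \<sigma> k)\<close>.\<close>

definition ev :: "nat \<Rightarrow> nat \<Rightarrow> nat \<Rightarrow> (nat \<Rightarrow> nat) \<Rightarrow> nat \<Rightarrow> (nat \<times> (nat \<Rightarrow> nat) \<Rightarrow> nat) \<Rightarrow> nat \<Rightarrow> nat" where
  "ev u L d \<sigma> L' r j = (\<Sum>\<gamma>\<in>expos u L'. d ^ code u L \<sigma> \<gamma> * r (j, \<gamma>))"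

text \<open>On coefficients, \<open>shift\<close> is multiplication by the \<open>k\<close>-th
  variable: lowering the \<open>k\<close>-th exponent matches the exponents with a possibly nonzero
  coefficient with those of \<open>r\<close>.\<close>

lemma ev_shift:
  assumes "k < u"
  shows "(\<Sum>\<gamma>\<in>expos u (Suc L). d ^ code u L \<sigma> \<gamma> * shift u L k r j \<gamma>) =
         d ^ (Suc L ^ \<sigma> k) * ev u L d \<sigma> L r j"
proof -
  define S where "S = {\<gamma> \<in> expos u (Suc L). 0 < \<gamma> k \<and> \<gamma>(k := \<gamma> k - 1) \<in> expos u L}"
  have "(\<Sum>\<gamma>\<in>expos u (Suc L). d ^ code u L \<sigma> \<gamma> * shift u L k r j \<gamma>) =
      (\<Sum>\<gamma>\<in>S. d ^ code u L \<sigma> \<gamma> * r (j, \<gamma>(k := \<gamma> k - 1)))"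
    by (rule sum.mono_neutral_cong_right) (auto simp: S_def shift_def)
  also have "\<dots> = (\<Sum>\<beta>\<in>expos u L. d ^ code u L \<sigma> (\<beta>(k := Suc (\<beta> k))) * r (j, \<beta>))"
  proof (rule sum.reindex_bij_witness[of _ "\<lambda>\<beta>. \<beta>(k := Suc (\<beta> k))" "\<lambda>\<gamma>. \<gamma>(k := \<gamma> k - 1)"])
    fix \<beta> assume \<beta>: "\<beta> \<in> expos u L"
    have "\<beta>(k := Suc (\<beta> k)) \<in> expos u (Suc L)"
      using \<beta> assms unfolding expos_def by (auto simp: PiE_iff extensional_def less_SucI)
    then show "\<beta>(k := Suc (\<beta> k)) \<in> S" using \<beta> by (simp add: S_def)
  qed (auto simp: S_def)
  also have "\<dots> = d ^ (Suc L ^ \<sigma> k) * ev u L d \<sigma> L r j"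
    using assms by (simp add: code_Suc power_add ev_def sum_distrib_left mult.assoc)
  finally show ?thesis .
qed

lemma ev_poly_hash:
  assumes "k < u" "j < m"
  shows "ev u L d \<sigma> (Suc L) (poly_hash u L m k x) j =
         ev u L d \<sigma> (Suc L) (fst x) j + d ^ (Suc L ^ \<sigma> k) * ev u L d \<sigma> L (snd x) j"
proof -
  have "ev u L d \<sigma> (Suc L) (poly_hash u L m k x) j =
      (\<Sum>\<gamma>\<in>expos u (Suc L). d ^ code u L \<sigma> \<gamma> * (fst x (j, \<gamma>) + shift u L k (snd x) j \<gamma>))"
    using assms(2) by (simp add: ev_def poly_hash_def)
  also have "\<dots> = ev u L d \<sigma> (Suc L) (fst x) j +
      (\<Sum>\<gamma>\<in>expos u (Suc L). d ^ code u L \<sigma> \<gamma> * shift u L k (snd x) j \<gamma>)"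
    by (simp add: distrib_left sum.distrib ev_def[of u L d \<sigma> "Suc L"])
  finally show ?thesis by (simp add: ev_shift[OF assms(1)])
qed

definition arrays :: "nat \<Rightarrow> nat \<Rightarrow> nat \<Rightarrow> nat \<Rightarrow> (nat \<times> (nat \<Rightarrow> nat) \<Rightarrow> nat) set" where
  "arrays u m L d = {..<m} \<times> expos u L \<rightarrow>\<^sub>E {..<d}"

lemma finite_arrays [simp]: "finite (arrays u m L d)"
  unfolding arrays_def by (intro finite_PiE) auto

lemma card_arrays [simp]: "card (arrays u m L d) = d ^ (m * L ^ u)"
  unfolding arrays_def by (simp add: card_PiE card_cartesian_product)

lemma arrays_ext:
  assumes "r \<in> arrays u m L d" "r' \<in> arrays u m L d"
    and "\<And>j \<gamma>. j < m \<Longrightarrow> \<gamma> \<in> expos u L \<Longrightarrow> r (j, \<gamma>) = r' (j, \<gamma>)"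
  shows "r = r'"
  using assms unfolding arrays_def
  by (intro PiE_ext[where k = "{..<m} \<times> expos u L" and s = "\<lambda>_. {..<d}"]) auto

text \<open>The coefficients are below \<open>d\<close> and, for injective \<sigma>, sit at distinct
  powers of \<open>d\<close>, so they are the base-\<open>d\<close> digits of the value.\<close>

lemma ev_inj:
  assumes "inj_on \<sigma> {..<u}" "r \<in> arrays u m L d" "r' \<in> arrays u m L d"
    and eq: "\<And>j. j < m \<Longrightarrow> ev u L d \<sigma> L r j = ev u L d \<sigma> L r' j"
  shows "r = r'"
proof (rule arrays_ext[OF assms(2,3)])
  fix j \<gamma> assume j: "j < m" and \<gamma>: "\<gamma> \<in> expos u L"
  have "\<forall>\<gamma>\<in>expos u L. r (j, \<gamma>) = r' (j, \<gamma>)"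
  proof (rule base_digits_unique[OF finite_expos inj_on_code[OF assms(1)]])
    show "r (j, \<gamma>) < d \<and> r' (j, \<gamma>) < d" if "\<gamma> \<in> expos u L" for \<gamma>
      using assms(2,3) that j unfolding arrays_def by (auto simp: PiE_iff)
  qed (use eq[OF j] in \<open>simp add: ev_def\<close>)
  then show "r (j, \<gamma>) = r' (j, \<gamma>)" using \<gamma> by blast
qed

text \<open>Ranks for the variables: the colours of a cycle get the ranks
  \<open>0, ..., l - 1\<close> along it, and a remaining colour \<open>c\<close> gets
  \<open>u + c\<close>, whence the bound \<open>2 * u\<close>.\<close>

definition orderings :: "nat \<Rightarrow> (nat \<Rightarrow> nat) set" where
  "orderings u = {..<u} \<rightarrow>\<^sub>E {..<2 * u}"

text \<open>For the ordering adapted to the cycle the values of the variables increase along it. The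
  evaluated \<open>p\<close> telescope, which leaves the equation of
  \<open>cyclic_convex_trivial\<close> for the evaluated \<open>r\<close>. So all \<open>r\<close>
  on the cycle coincide, and then the first two vertices have the same \<open>p\<close> as well,
  against injectivity.\<close>

lemma no_rainbow_cycle_poly_hash:
  fixes M :: "(nat \<Rightarrow> nat) \<Rightarrow> nat"
  assumes d: "2 \<le> d" and L: "1 \<le> L"
    and R: "R \<subseteq> {r \<in> arrays u m L d. \<forall>\<sigma>\<in>orderings u. (\<Sum>j<m. (ev u L d \<sigma> L r j)\<^sup>2) = M \<sigma>}"
  shows "\<not> rainbow_cycle u (arrays u m (Suc L) d \<times> R) (poly_hash u L m) l v k"
proof
  assume "rainbow_cycle u (arrays u m (Suc L) d \<times> R) (poly_hash u L m) l v k"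
  then have l: "2 \<le> l" and v: "inj_on v {..<l}" "v ` {..<l} \<subseteq> arrays u m (Suc L) d \<times> R"
    and k: "inj_on k {..<l}" "k ` {..<l} \<subseteq> {..<u}"
    and eq: "\<And>i. i < l \<Longrightarrow> poly_hash u L m (k i) (v i) = poly_hash u L m (k i) (v (Suc i mod l))"
    unfolding rainbow_cycle_def by auto
  have lu: "l \<le> u" using card_inj_on_le[OF k] by simp
  define \<sigma> where "\<sigma> = (\<lambda>c\<in>{..<u}. if c \<in> k ` {..<l} then inv_into {..<l} k c else u + c)"
  have \<sigma>k: "\<sigma> (k i) = i" if "i < l" for i
    using that k by (auto simp: \<sigma>_def)
  have inv: "inv_into {..<l} k c < u" if "c \<in> k ` {..<l}" for c
    using inv_into_into[OF that] lu by simp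
  have \<sigma>: "\<sigma> \<in> orderings u"
    unfolding orderings_def
  proof (rule PiE_I)
    fix c assume "c \<in> {..<u}"
    then show "\<sigma> c \<in> {..<2 * u}" using inv[of c] by (cases "c \<in> k ` {..<l}") (simp_all add: \<sigma>_def)
  qed (simp add: \<sigma>_def)
  have inj: "inj_on \<sigma> {..<u}"
  proof (rule inj_onI)
    fix a b assume ab: "a \<in> {..<u}" "b \<in> {..<u}" "\<sigma> a = \<sigma> b"
    show "a = b"
    proof (cases "a \<in> k ` {..<l} \<and> b \<in> k ` {..<l}")
      case True
      with ab show ?thesis by (auto simp: \<sigma>_def dest: inv_into_injective)
    next
      case False
      with ab inv[of a] inv[of b] show ?thesis by (auto simp: \<sigma>_def split: if_splits)
    qed
  qed
  \<comment> \<open>Periodic extension, so that the closing edge joins \<open>w (l - 1)\<close> to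
    \<open>w l = w 0\<close>.\<close>
  define w where "w i = v (i mod l)" for i
  have w: "w i \<in> arrays u m (Suc L) d \<times> R" for i
    using v(2) l unfolding w_def by (metis imageI subsetD lessThan_iff mod_less_divisor zero_less_numeral order_less_le_trans)
  have wR: "snd (w i) \<in> arrays u m L d" "(\<Sum>j<m. (ev u L d \<sigma> L (snd (w i)) j)\<^sup>2) = M \<sigma>" for i
    using w[of i] R \<sigma> by (auto simp: mem_Times_iff)
  have wl: "w l = w 0" by (simp add: w_def)
  have weq: "poly_hash u L m (k i) (w i) = poly_hash u L m (k i) (w (Suc i))" if "i < l" for i
    using eq[OF that] that by (simp add: w_def)
  define s where "s i j = real (ev u L d \<sigma> L (snd (w i)) j)" for i j
  define P where "P i j = real (ev u L d \<sigma> (Suc L) (fst (w i)) j)" for i j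
  define t where "t i = real d ^ (Suc L ^ i)" for i
  have seq: "\<forall>j\<in>{..<m}. s i j = s 0 j" if "i < l" for i
  proof (rule cyclic_convex_trivial[OF _ _ _ _ _ that])
    show "t i < t i'" if "i < i'" for i i'
      unfolding t_def using d L that by (intro power_strict_increasing) auto
    show "(\<Sum>i<l. t i * (s (Suc i) j - s i j)) = 0" if j: "j \<in> {..<m}" for j
    proof -
      have "t i * (s (Suc i) j - s i j) = P i j - P (Suc i) j" if "i < l" for i
      proof -
        have ki: "k i < u" using k(2) that by auto
        have "ev u L d \<sigma> (Suc L) (poly_hash u L m (k i) (w i)) j =
            ev u L d \<sigma> (Suc L) (poly_hash u L m (k i) (w (Suc i))) j"
          using weq[OF that] by simp
        then have "real (ev u L d \<sigma> (Suc L) (fst (w i)) j + d ^ (Suc L ^ i) * ev u L d \<sigma> L (snd (w i)) j) =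
            real (ev u L d \<sigma> (Suc L) (fst (w (Suc i))) j + d ^ (Suc L ^ i) * ev u L d \<sigma> L (snd (w (Suc i))) j)"
          using j ki by (simp add: ev_poly_hash \<sigma>k[OF that])
        then show ?thesis by (simp add: t_def s_def P_def algebra_simps)
      qed
      then have "(\<Sum>i<l. t i * (s (Suc i) j - s i j)) = (\<Sum>i<l. P i j - P (Suc i) j)" by simp
      also have "\<dots> = P 0 j - P l j" by (rule sum_lessThan_telescope')
      finally show ?thesis by (simp add: P_def wl)
    qed
    show "(\<Sum>j\<in>{..<m}. (s i j)\<^sup>2) = real (M \<sigma>)" for i
      unfolding s_def wR(2)[of i, symmetric] by simp
  qed (auto simp: s_def wl)
  have "ev u L d \<sigma> L (snd (w 1)) j = ev u L d \<sigma> L (snd (w 0)) j" if "j < m" for j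
    using seq[of 1] that l by (simp add: s_def)
  from ev_inj[OF inj wR(1) wR(1) this] have r: "snd (w 1) = snd (w 0)" .
  have "fst (w 1) = fst (w 0)"
  proof (rule arrays_ext)
    show "fst (w 1) \<in> arrays u m (Suc L) d" "fst (w 0) \<in> arrays u m (Suc L) d"
      using w[of 1] w[of 0] by (auto simp: mem_Times_iff)
    fix j \<gamma> assume "j < m" "\<gamma> \<in> expos u (Suc L)"
    then show "fst (w 1) (j, \<gamma>) = fst (w 0) (j, \<gamma>)"
      using fun_cong[OF weq[of 0], of "(j, \<gamma>)"] l r by (simp add: poly_hash_def)
  qed
  with r have "v 1 = v 0" using l by (simp add: w_def prod_eq_iff)
  then show False using v(1) l by (auto dest: inj_onD)
qed

lemma poly_hash_hash_family:
  assumes "R \<subseteq> arrays u m L d"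
  shows "hash_family u (arrays u m (Suc L) d \<times> R) (arrays u m (Suc L) (2 * d)) (poly_hash u L m)"
  unfolding hash_family_def
proof (intro allI impI funcsetI)
  fix k x assume "k < u" and x: "x \<in> arrays u m (Suc L) d \<times> R"
  have "poly_hash u L m k x (j, \<gamma>) < 2 * d" if "j < m" "\<gamma> \<in> expos u (Suc L)" for j \<gamma>
  proof -
    have "fst x (j, \<gamma>) < d" using x that unfolding arrays_def by (auto simp: PiE_iff)
    moreover have "shift u L k (snd x) j \<gamma> < d"
    proof (cases "0 < \<gamma> k \<and> \<gamma>(k := \<gamma> k - 1) \<in> expos u L")
      case True
      moreover have "snd x \<in> arrays u m L d" using x assms by auto
      ultimately show ?thesis using that unfolding shift_def arrays_def by (auto simp: PiE_iff)
    next
      case False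
      then show ?thesis using \<open>fst x (j, \<gamma>) < d\<close> by (auto simp: shift_def)
    qed
    ultimately show ?thesis using that by (simp add: poly_hash_def)
  qed
  then show "poly_hash u L m k x \<in> arrays u m (Suc L) (2 * d)"
    unfolding arrays_def by (auto simp: PiE_iff poly_hash_def)
qed

text \<open>Pigeonhole over the vectors of squared norms, with one entry for each ordering. The
  constant \<open>C\<close> does not depend on the dimension \<open>m\<close>, so the loss is
  polynomial in \<open>m\<close>, while the number of pairs is exponential in
  \<open>m\<close>.\<close>

lemma SHF_sizes_poly_hash:
  assumes d: "2 \<le> d" and L: "1 \<le> L" and u: "1 \<le> u"
  shows "\<exists>C. \<forall>m q W. (2 * d) ^ (m * Suc L ^ u) \<le> q \<longrightarrow> sum_mset W \<le> u \<longrightarrow>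
           (\<exists>n\<in>SHF_sizes u q W. d ^ (m * (L ^ u + Suc L ^ u)) \<le> n * Suc (m * C) ^ ((2 * u) ^ u))"
proof -
  \<comment> \<open>\<open>Z\<close> bounds every evaluation uniformly in \<open>j\<close>, \<sigma>
    and \<open>r\<close>; hence each squared norm is at most \<open>m * Z\<^sup>2\<close>.\<close>
  define Z where "Z = (\<Sum>\<sigma>\<in>orderings u. \<Sum>\<gamma>\<in>expos u L. d ^ code u L \<sigma> \<gamma> * d)"
  have fin: "finite (orderings u)" unfolding orderings_def by (intro finite_PiE) auto
  have "\<exists>n\<in>SHF_sizes u q W. d ^ (m * (L ^ u + Suc L ^ u)) \<le> n * Suc (m * Z\<^sup>2) ^ ((2 * u) ^ u)"
    if q: "(2 * d) ^ (m * Suc L ^ u) \<le> q" and W: "sum_mset W \<le> u" for m q W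
  proof -
    define \<Phi> where "\<Phi> r = (\<lambda>\<sigma>\<in>orderings u. \<Sum>j<m. (ev u L d \<sigma> L r j)\<^sup>2)" for r
    have "\<Phi> r \<in> orderings u \<rightarrow>\<^sub>E {..<Suc (m * Z\<^sup>2)}" if r: "r \<in> arrays u m L d" for r
    proof -
      have "ev u L d \<sigma> L r j \<le> Z" if "j < m" "\<sigma> \<in> orderings u" for j \<sigma>
      proof -
        have "ev u L d \<sigma> L r j \<le> (\<Sum>\<gamma>\<in>expos u L. d ^ code u L \<sigma> \<gamma> * d)"
          unfolding ev_def using r that(1) unfolding arrays_def
          by (intro sum_mono mult_left_mono) (auto simp: PiE_iff less_imp_le)
        also have "\<dots> \<le> Z" unfolding Z_def using fin that(2) by (intro member_le_sum) auto
        finally show ?thesis .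
      qed
      then have "(\<Sum>j<m. (ev u L d \<sigma> L r j)\<^sup>2) \<le> m * Z\<^sup>2" if "\<sigma> \<in> orderings u" for \<sigma>
        using sum_bounded_above[of "{..<m}" "\<lambda>j. (ev u L d \<sigma> L r j)\<^sup>2" "Z\<^sup>2"] that
        by (simp add: power_mono)
      then show ?thesis by (auto simp: \<Phi>_def PiE_iff less_Suc_eq_le)
    qed
    then have "\<Phi> \<in> arrays u m L d \<rightarrow> (orderings u \<rightarrow>\<^sub>E {..<Suc (m * Z\<^sup>2)})" by blast
    moreover have "(orderings u \<rightarrow>\<^sub>E {..<Suc (m * Z\<^sup>2)}) \<noteq> {}" by (simp add: PiE_eq_empty_iff lessThan_empty_iff)
    moreover have "finite (orderings u \<rightarrow>\<^sub>E {..<Suc (m * Z\<^sup>2)})" using fin by (intro finite_PiE) auto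
    ultimately obtain M where M: "card (\<Phi> -` {M} \<inter> arrays u m L d) *
        card (orderings u \<rightarrow>\<^sub>E {..<Suc (m * Z\<^sup>2)}) \<ge> card (arrays u m L d)"
      using pigeonhole_card[of \<Phi>] finite_arrays by meson
    have c: "card (orderings u \<rightarrow>\<^sub>E {..<Suc (m * Z\<^sup>2)}) = Suc (m * Z\<^sup>2) ^ ((2 * u) ^ u)"
      using fin by (simp add: card_PiE) (simp add: orderings_def card_PiE)
    define R where "R = \<Phi> -` {M} \<inter> arrays u m L d"
    have R: "R \<subseteq> arrays u m L d" by (simp add: R_def)
    have "R \<subseteq> {r \<in> arrays u m L d. \<forall>\<sigma>\<in>orderings u. (\<Sum>j<m. (ev u L d \<sigma> L r j)\<^sup>2) = M \<sigma>}"
      unfolding R_def by (auto simp: \<Phi>_def)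
    note no = no_rainbow_cycle_poly_hash[OF d L this]
    have "d ^ (m * Suc L ^ u) * card R \<in> SHF_sizes u q W"
    proof (rule SHF_sizes_if_no_rainbow_cycle[OF _ _ _ _ poly_hash_hash_family[OF R] W u no])
      show "finite (arrays u m (Suc L) d \<times> R)" using finite_subset[OF R] by simp
      show "card (arrays u m (Suc L) d \<times> R) = d ^ (m * Suc L ^ u) * card R"
        by (simp add: card_cartesian_product del: power_Suc)
      show "card (arrays u m (Suc L) (2 * d)) \<le> q" using q by (simp del: power_Suc)
    qed simp
    moreover have "d ^ (m * (L ^ u + Suc L ^ u)) \<le>
        d ^ (m * Suc L ^ u) * card R * Suc (m * Z\<^sup>2) ^ ((2 * u) ^ u)"
    proof -
      have "d ^ (m * L ^ u) \<le> card R * Suc (m * Z\<^sup>2) ^ ((2 * u) ^ u)"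
        using M by (simp add: c R_def)
      then have "d ^ (m * Suc L ^ u) * d ^ (m * L ^ u) \<le>
          d ^ (m * Suc L ^ u) * (card R * Suc (m * Z\<^sup>2) ^ ((2 * u) ^ u))"
        by (rule mult_left_mono) simp
      then show ?thesis by (simp only: distrib_left power_add mult.assoc mult.commute[of "d ^ (m * L ^ u)"])
    qed
    ultimately show ?thesis by blast
  qed
  then show ?thesis by blast
qed

section \<open>Regular cells\<close>

text \<open>The conditional expectation of \<open>f\<close> given the partition of \<Omega> into the
  fibres of \<kappa>.\<close>

definition avg :: "'o set \<Rightarrow> ('o \<Rightarrow> 'k) \<Rightarrow> ('o \<Rightarrow> real) \<Rightarrow> 'o \<Rightarrow> real" where
  "avg \<Omega> \<kappa> f x = (\<Sum>y | y \<in> \<Omega> \<and> \<kappa> y = \<kappa> x. f y) / card {y \<in> \<Omega>. \<kappa> y = \<kappa> x}"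

lemma avg_cong: "\<kappa> x = \<kappa> y \<Longrightarrow> avg \<Omega> \<kappa> f x = avg \<Omega> \<kappa> f y"
  by (simp add: avg_def)

text \<open>A weight that is constant on the cells does not distinguish \<open>f\<close> from its
  cell averages; the proof exchanges the two sums over pairs in a common cell.\<close>

lemma sum_mult_avg:
  assumes fin: "finite \<Omega>"
    and g: "\<And>x y. x \<in> \<Omega> \<Longrightarrow> y \<in> \<Omega> \<Longrightarrow> \<kappa> x = \<kappa> y \<Longrightarrow> g x = g y"
  shows "(\<Sum>x\<in>\<Omega>. g x * avg \<Omega> \<kappa> f x) = (\<Sum>x\<in>\<Omega>. g x * f x)"
proof -
  let ?cell = "\<lambda>x. {y \<in> \<Omega>. \<kappa> y = \<kappa> x}"
  have "(\<Sum>x\<in>\<Omega>. g x * avg \<Omega> \<kappa> f x) = (\<Sum>x\<in>\<Omega>. \<Sum>y\<in>\<Omega>. if \<kappa> y = \<kappa> x then g x * f y / card (?cell x) else 0)"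
  proof (intro sum.cong refl)
    fix x
    have "g x * avg \<Omega> \<kappa> f x = (\<Sum>y | y \<in> \<Omega> \<and> \<kappa> y = \<kappa> x. g x * f y / card (?cell x))"
      by (simp only: avg_def sum_distrib_left sum_divide_distrib times_divide_eq_right)
    also have "\<dots> = (\<Sum>y\<in>\<Omega>. if \<kappa> y = \<kappa> x then g x * f y / card (?cell x) else 0)"
      by (rule sum.inter_filter[OF fin])
    finally show "g x * avg \<Omega> \<kappa> f x = \<dots>" .
  qed
  also have "\<dots> = (\<Sum>y\<in>\<Omega>. \<Sum>x\<in>\<Omega>. if \<kappa> y = \<kappa> x then g x * f y / card (?cell x) else 0)"
    by (rule sum.swap)
  also have "\<dots> = (\<Sum>y\<in>\<Omega>. \<Sum>x\<in>\<Omega>. if \<kappa> x = \<kappa> y then g y * f y / card (?cell y) else 0)"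
  proof (intro sum.cong refl)
    fix y x assume "y \<in> \<Omega>" "x \<in> \<Omega>"
    then show "(if \<kappa> y = \<kappa> x then g x * f y / card (?cell x) else 0) =
        (if \<kappa> x = \<kappa> y then g y * f y / card (?cell y) else 0)"
      using g[of x y] by (cases "\<kappa> x = \<kappa> y") simp_all
  qed
  also have "\<dots> = (\<Sum>y\<in>\<Omega>. g y * f y)"
  proof (intro sum.cong refl)
    fix y assume "y \<in> \<Omega>"
    then have "card (?cell y) > 0" using fin by (auto simp: card_gt_0_iff)
    then show "(\<Sum>x\<in>\<Omega>. if \<kappa> x = \<kappa> y then g y * f y / card (?cell y) else 0) = g y * f y"
      by (subst sum.inter_filter[OF fin, symmetric]) simp
  qed
  finally show ?thesis .
qed

text \<open>Pythagoras: the average over the finer partition minus that over the coarser one is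
  orthogonal to every function constant on the coarser cells.\<close>

lemma sum_avg_square_refine:
  assumes fin: "finite \<Omega>" and ref: "\<And>x y. x \<in> \<Omega> \<Longrightarrow> y \<in> \<Omega> \<Longrightarrow> \<kappa>' x = \<kappa>' y \<Longrightarrow> \<kappa> x = \<kappa> y"
  shows "(\<Sum>x\<in>\<Omega>. (avg \<Omega> \<kappa>' f x)\<^sup>2) =
         (\<Sum>x\<in>\<Omega>. (avg \<Omega> \<kappa> f x)\<^sup>2) + (\<Sum>x\<in>\<Omega>. (avg \<Omega> \<kappa>' f x - avg \<Omega> \<kappa> f x)\<^sup>2)"
proof -
  let ?D = "avg \<Omega> \<kappa> f" and ?D' = "avg \<Omega> \<kappa>' f"
  have "(\<Sum>x\<in>\<Omega>. ?D x * ?D' x) = (\<Sum>x\<in>\<Omega>. ?D x * f x)"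
    by (intro sum_mult_avg fin avg_cong ref)
  also have "\<dots> = (\<Sum>x\<in>\<Omega>. ?D x * ?D x)"
    by (intro sum_mult_avg[symmetric] fin avg_cong)
  finally have "(\<Sum>x\<in>\<Omega>. ?D x * ?D' x) = (\<Sum>x\<in>\<Omega>. (?D x)\<^sup>2)" by (simp add: power2_eq_square)
  then show ?thesis
    by (simp add: power2_diff sum.distrib sum_subtractf sum_distrib_left[symmetric] mult.assoc mult.commute[of "?D' _"])
qed

section \<open>Partitions generated by families of sets\<close>

definition atom :: "'v set \<Rightarrow> 'v set set \<Rightarrow> 'v \<Rightarrow> 'v set" where
  "atom V F v = {w \<in> V. \<forall>W\<in>F. w \<in> W \<longleftrightarrow> v \<in> W}"

lemma atom_eq_iff: "v \<in> V \<Longrightarrow> w \<in> V \<Longrightarrow> atom V F v = atom V F w \<longleftrightarrow> w \<in> atom V F v"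
  unfolding atom_def by blast

lemma atom_self: "v \<in> V \<Longrightarrow> v \<in> atom V F v"
  unfolding atom_def by blast

lemma atom_subset: "atom V F v \<subseteq> V"
  unfolding atom_def by blast

lemma atom_refine: "v \<in> V \<Longrightarrow> w \<in> V \<Longrightarrow> F \<subseteq> F' \<Longrightarrow> atom V F' v = atom V F' w \<Longrightarrow> atom V F v = atom V F w"
  by (auto simp: atom_eq_iff) (auto simp: atom_def)

text \<open>An atom is determined by the set of those members of \<open>F\<close> that contain
  it.\<close>

lemma card_atoms:
  assumes "finite F"
  shows "card (atom V F ` V) \<le> 2 ^ card F" "finite (atom V F ` V)"
proof -
  have "atom V F ` V \<subseteq> (\<lambda>S. {w \<in> V. \<forall>W\<in>F. w \<in> W \<longleftrightarrow> W \<in> S}) ` Pow F"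
  proof
    fix A assume "A \<in> atom V F ` V"
    then obtain v where "v \<in> V" "A = atom V F v" by blast
    then have "A = (\<lambda>S. {w \<in> V. \<forall>W\<in>F. w \<in> W \<longleftrightarrow> W \<in> S}) {W\<in>F. v \<in> W}"
      unfolding atom_def by blast
    then show "A \<in> (\<lambda>S. {w \<in> V. \<forall>W\<in>F. w \<in> W \<longleftrightarrow> W \<in> S}) ` Pow F" by blast
  qed
  moreover have "finite (Pow F)" using assms by simp
  ultimately have "card (atom V F ` V) \<le> card (Pow F)" "finite (atom V F ` V)"
    by (rule surj_card_le[rotated], rule finite_surj[rotated])
  then show "card (atom V F ` V) \<le> 2 ^ card F" "finite (atom V F ` V)"
    using assms by (simp_all add: card_Pow)
qed

definition dens :: "('v \<times> 'v) set \<Rightarrow> 'v set \<Rightarrow> 'v set \<Rightarrow> real" where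
  "dens G A B = card (G \<inter> A \<times> B) / (card A * card B)"

definition atom_pair :: "'v set \<Rightarrow> 'v set set \<Rightarrow> 'v \<times> 'v \<Rightarrow> 'v set \<times> 'v set" where
  "atom_pair V F x = (atom V F (fst x), atom V F (snd x))"

lemma atom_pair_cell:
  assumes "x \<in> V \<times> V"
  shows "{y \<in> V \<times> V. atom_pair V F y = atom_pair V F x} = atom V F (fst x) \<times> atom V F (snd x)"
proof -
  have "y \<in> V \<times> V \<and> atom_pair V F y = atom_pair V F x \<longleftrightarrow> y \<in> atom V F (fst x) \<times> atom V F (snd x)" for y
  proof -
    have "atom V F (fst x) = atom V F (fst y) \<longleftrightarrow> fst y \<in> atom V F (fst x)" if "fst y \<in> V"
      using that assms by (intro atom_eq_iff) auto
    moreover have "atom V F (snd x) = atom V F (snd y) \<longleftrightarrow> snd y \<in> atom V F (snd x)" if "snd y \<in> V"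
      using that assms by (intro atom_eq_iff) auto
    ultimately show ?thesis
      using subsetD[OF atom_subset[of V F "fst x"], of "fst y"] subsetD[OF atom_subset[of V F "snd x"], of "snd y"]
      unfolding atom_pair_def mem_Times_iff by auto
  qed
  then show ?thesis by blast
qed

text \<open>Written as a conditional expectation of the indicator of \<open>G\<close>, so that the
  Pythagoras identity applies; \<open>cell_dens_eq\<close> identifies it with the density of
  \<open>G\<close> between two atoms.\<close>

definition cell_dens :: "'v set \<Rightarrow> ('v \<times> 'v) set \<Rightarrow> 'v set set \<Rightarrow> 'v \<times> 'v \<Rightarrow> real" where
  "cell_dens V G F = avg (V \<times> V) (atom_pair V F) (\<lambda>x. of_bool (x \<in> G))"

lemma cell_dens_eq:
  assumes "finite V" "x \<in> V \<times> V"
  shows "cell_dens V G F x = dens G (atom V F (fst x)) (atom V F (snd x))"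
proof -
  have "finite (atom V F (fst x) \<times> atom V F (snd x))"
    using finite_subset[OF atom_subset assms(1)] by blast
  then show ?thesis
    using atom_pair_cell[OF assms(2), of F]
    by (simp add: cell_dens_def avg_def dens_def card_cartesian_product Int_def conj_commute)
qed

lemma cell_dens_bounds:
  assumes "finite V" "x \<in> V \<times> V"
  shows "0 \<le> cell_dens V G F x" "cell_dens V G F x \<le> 1"
proof -
  let ?A = "atom V F (fst x)" and ?B = "atom V F (snd x)"
  have "finite (?A \<times> ?B)"
    using finite_subset[OF atom_subset assms(1)] by blast
  then have "card (G \<inter> ?A \<times> ?B) \<le> card (?A \<times> ?B)" by (intro card_mono) auto
  then have "real (card (G \<inter> ?A \<times> ?B)) \<le> real (card ?A) * real (card ?B)"
    by (simp only: card_cartesian_product flip: of_nat_mult of_nat_le_iff)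
  moreover have "0 \<le> real (card ?A) * real (card ?B)" by simp
  ultimately have "real (card (G \<inter> ?A \<times> ?B)) / (real (card ?A) * real (card ?B)) \<le> 1"
    unfolding divide_le_eq_1 by linarith
  then show "0 \<le> cell_dens V G F x" "cell_dens V G F x \<le> 1"
    unfolding cell_dens_eq[OF assms] dens_def by simp_all
qed

section \<open>Energy increments\<close>

definition energy :: "'v set \<Rightarrow> ('v \<times> 'v) set \<Rightarrow> 'v set set \<Rightarrow> real" where
  "energy V G F = (\<Sum>x\<in>V \<times> V. (cell_dens V G F x)\<^sup>2)"

lemma energy_le:
  assumes "finite V"
  shows "energy V G F \<le> (real (card V))\<^sup>2"
proof -
  have "energy V G F \<le> (\<Sum>x\<in>V \<times> V. 1)"
    unfolding energy_def using cell_dens_bounds[OF assms] by (intro sum_mono) (simp add: power_le_one)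
  then show ?thesis by (simp add: card_cartesian_product power2_eq_square)
qed

lemma energy_nonneg: "0 \<le> energy V G F"
  unfolding energy_def by (intro sum_nonneg) simp

text \<open>Only the lower half of Szemeredi's regularity is needed.\<close>

definition lower_regular :: "real \<Rightarrow> ('v \<times> 'v) set \<Rightarrow> 'v set \<Rightarrow> 'v set \<Rightarrow> bool" where
  "lower_regular \<delta> G A B \<longleftrightarrow>
     (\<forall>A' B'. A' \<subseteq> A \<longrightarrow> B' \<subseteq> B \<longrightarrow> \<delta> * card A \<le> card A' \<longrightarrow> \<delta> * card B \<le> card B' \<longrightarrow>
        \<delta> * (card A' * card B') \<le> card (G \<inter> A' \<times> B'))"

text \<open>Edges are counted instead of pairs of cells. The threshold \<open>2 * \<delta>\<close>
  leaves a gap \<delta> to the density of a witness of irregularity, which is below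
  \<delta>.\<close>

definition irregular_edges :: "real \<Rightarrow> 'v set \<Rightarrow> ('v \<times> 'v) set \<Rightarrow> 'v set set \<Rightarrow> ('v \<times> 'v) set" where
  "irregular_edges \<delta> V G F =
     {x \<in> G. 2 * \<delta> \<le> cell_dens V G F x \<and> \<not> lower_regular \<delta> G (atom V F (fst x)) (atom V F (snd x))}"

lemma sum_of_bool_mult:
  fixes f :: "'a \<Rightarrow> real"
  assumes "finite A" "B \<subseteq> A"
  shows "(\<Sum>x\<in>A. of_bool (x \<in> B) * f x) = sum f B"
  using assms by (intro sum.mono_neutral_cong_right) auto

text \<open>For each irregular pair of cells both sides of a witness rectangle are added to
  \<open>F\<close>. If the pair has density at least \<open>2 * \<delta>\<close>, the rectangle
  fills at least the fraction \<open>\<delta>\<^sup>2\<close> of it, and on the rectangle the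
  density drops by more than \<delta> on average. By Pythagoras this gains at least
  \<open>\<delta> ^ 4\<close> per point of the pair.\<close>

lemma energy_increment:
  assumes V: "finite V" and G: "G \<subseteq> V \<times> V" and F: "finite F" and \<delta>: "0 < \<delta>"
  shows "\<exists>F'. F \<subseteq> F' \<and> finite F' \<and> card F' \<le> card F + 2 * (2 ^ card F)\<^sup>2 \<and>
           energy V G F + \<delta> ^ 4 * card (irregular_edges \<delta> V G F) \<le> energy V G F'"
proof -
  define wit where "wit = (\<lambda>(A, B) (A', B'). A' \<subseteq> A \<and> B' \<subseteq> B \<and> \<delta> * card A \<le> card A' \<and>
     \<delta> * card B \<le> card B' \<and> card (G \<inter> A' \<times> B') < \<delta> * (card A' * card B'))"
  define w where "w AB = (SOME AB'. wit AB AB')" for AB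
  have w: "wit (A, B) (w (A, B))" if "\<not> lower_regular \<delta> G A B" for A B
  proof -
    have "\<exists>AB'. wit (A, B) AB'"
      using that unfolding lower_regular_def wit_def by (auto simp: not_le)
    then show ?thesis unfolding w_def by (rule someI_ex)
  qed
  define S where "S = atom V F ` V \<times> atom V F ` V"
  define F' where "F' = F \<union> ((\<lambda>s. fst (w s)) ` S \<union> (\<lambda>s. snd (w s)) ` S)"
  have S: "finite S" "card S \<le> (2 ^ card F)\<^sup>2"
    unfolding S_def using card_atoms[OF F, of V]
    by (auto simp: card_cartesian_product power2_eq_square intro: mult_mono)
  have "card F' \<le> card F + (card S + card S)"
    unfolding F'_def using S(1) card_image_le[OF S(1)]
    by (meson add_mono card_Un_le le_trans order_refl)
  with S(2) have cF': "card F' \<le> card F + 2 * (2 ^ card F)\<^sup>2" by linarith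
  have fF': "finite F'" using F S(1) by (simp add: F'_def)
  let ?\<Omega> = "V \<times> V"
  let ?D = "cell_dens V G F" and ?D' = "cell_dens V G F'"
  let ?I = "irregular_edges \<delta> V G F"
  define h where "h x = (?D' x - ?D x)\<^sup>2" for x
  have fO: "finite ?\<Omega>" using V by simp
  have "energy V G F' = energy V G F + (\<Sum>x\<in>?\<Omega>. h x)"
    unfolding energy_def h_def cell_dens_def
  proof (rule sum_avg_square_refine[OF fO])
    fix x y assume "x \<in> ?\<Omega>" "y \<in> ?\<Omega>" "atom_pair V F' x = atom_pair V F' y"
    then show "atom_pair V F x = atom_pair V F y"
      using atom_refine[of "fst x" V "fst y" F F'] atom_refine[of "snd x" V "snd y" F F']
      by (auto simp: atom_pair_def F'_def)
  qed
  moreover have "\<delta> ^ 4 * card ?I \<le> (\<Sum>x\<in>?\<Omega>. h x)"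
  proof -
    have "?I \<subseteq> ?\<Omega>" using G by (auto simp: irregular_edges_def)
    then have "\<delta> ^ 4 * card ?I = (\<Sum>x\<in>?\<Omega>. \<delta> ^ 4 * of_bool (x \<in> ?I))"
      using fO by (simp flip: sum_distrib_left add: Int_absorb1)
    \<comment> \<open>The gain is compared on each pair of cells of the old partition
      separately.\<close>
    also have "\<dots> = (\<Sum>k\<in>atom_pair V F ` ?\<Omega>. \<Sum>x | x \<in> ?\<Omega> \<and> atom_pair V F x = k. \<delta> ^ 4 * of_bool (x \<in> ?I))"
      by (rule sum.image_gen[OF fO])
    also have "\<dots> \<le> (\<Sum>k\<in>atom_pair V F ` ?\<Omega>. \<Sum>x | x \<in> ?\<Omega> \<and> atom_pair V F x = k. h x)"
    proof (rule sum_mono)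
      fix k assume "k \<in> atom_pair V F ` ?\<Omega>"
      let ?cell = "{x. x \<in> ?\<Omega> \<and> atom_pair V F x = k}"
      have h0: "0 \<le> sum h T" for T by (intro sum_nonneg) (simp add: h_def)
      show "(\<Sum>x\<in>?cell. \<delta> ^ 4 * of_bool (x \<in> ?I)) \<le> sum h ?cell"
      proof (cases "?cell \<inter> ?I = {}")
        case True
        then have "(\<Sum>x\<in>?cell. \<delta> ^ 4 * of_bool (x \<in> ?I)) = 0"
          by (intro sum.neutral) auto
        then show ?thesis using h0 by simp
      next
        case False
        then obtain z where z: "z \<in> ?\<Omega>" "atom_pair V F z = k" "z \<in> ?I" by blast
        define A B where "A = atom V F (fst z)" and "B = atom V F (snd z)"
        have cell: "?cell = A \<times> B" using atom_pair_cell[OF z(1), of F] z(2) by (simp add: A_def B_def)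
        define A' B' where "A' = fst (w (A, B))" and "B' = snd (w (A, B))"
        have "wit (A, B) (w (A, B))"
          using z(3) by (intro w) (simp add: irregular_edges_def A_def B_def)
        then have AB': "A' \<subseteq> A" "B' \<subseteq> B" "\<delta> * card A \<le> card A'" "\<delta> * card B \<le> card B'"
          "card (G \<inter> A' \<times> B') < \<delta> * (card A' * card B')"
          by (auto simp: wit_def A'_def B'_def split_beta)
        have "(A, B) \<in> S" using z(1) by (auto simp: S_def A_def B_def)
        then have "A' \<in> F'" "B' \<in> F'" by (auto simp: F'_def A'_def B'_def)
        have AV: "A \<subseteq> V" "B \<subseteq> V" by (simp_all add: A_def B_def atom_subset)
        have fin: "finite A" "finite B" using AV V finite_subset by blast+
        have sub: "A' \<times> B' \<subseteq> ?\<Omega>" using AV AB' by blast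
        \<comment> \<open>Since \<open>A'\<close> and \<open>B'\<close> belong to \<open>F'\<close>,
          the rectangle is a union of cells of the new partition, so averaging preserves the number
          of its edges.\<close>
        have "(\<Sum>x\<in>?\<Omega>. of_bool (x \<in> A' \<times> B') * ?D' x) = (\<Sum>x\<in>?\<Omega>. of_bool (x \<in> A' \<times> B') * of_bool (x \<in> G))"
          unfolding cell_dens_def
        proof (rule sum_mult_avg[OF fO])
          fix x y assume xy: "x \<in> ?\<Omega>" "y \<in> ?\<Omega>" "atom_pair V F' x = atom_pair V F' y"
          then have "fst y \<in> atom V F' (fst x)" "snd y \<in> atom V F' (snd x)"
            using atom_self[of "fst y" V F'] atom_self[of "snd y" V F']
            by (auto simp: atom_pair_def)
          then show "of_bool (x \<in> A' \<times> B') = (of_bool (y \<in> A' \<times> B') :: real)"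
            using \<open>A' \<in> F'\<close> \<open>B' \<in> F'\<close> by (auto simp: atom_def mem_Times_iff)
        qed
        then have sD': "(\<Sum>x\<in>A' \<times> B'. ?D' x) = card (G \<inter> A' \<times> B')"
          using sum_of_bool_mult[OF fO sub, of ?D'] sum_of_bool_mult[OF fO sub, of "\<lambda>x. of_bool (x \<in> G)"]
            finite_subset[OF sub fO] by (simp only:) (simp add: Int_commute)
        have Dz: "?D x = ?D z" if "x \<in> A' \<times> B'" for x
        proof -
          have "x \<in> ?cell" using that AB'(1,2) unfolding cell by blast
          then show ?thesis using z(2) unfolding cell_dens_def by (intro avg_cong) simp
        qed
        have d: "2 * \<delta> \<le> ?D z" using z(3) by (simp add: irregular_edges_def)
        have "(\<Sum>x\<in>?cell. \<delta> ^ 4 * of_bool (x \<in> ?I)) \<le> (\<Sum>x\<in>A \<times> B. \<delta> ^ 4)"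
          unfolding cell using \<delta> by (intro sum_mono) auto
        also have "\<dots> = \<delta>\<^sup>2 * ((\<delta> * card A) * (\<delta> * card B))"
          by (simp add: card_cartesian_product power2_eq_square power4_eq_xxxx)
        also have "\<dots> \<le> \<delta>\<^sup>2 * (card A' * card B')"
          using AB'(3,4) \<delta> by (intro mult_left_mono) (auto intro!: mult_mono)
        \<comment> \<open>Prepares the inequality
          \<open>2 * \<delta> * x - \<delta>\<^sup>2 \<le> x\<^sup>2\<close>, applied pointwise
          below with \<open>x\<close> the drop in density; it takes the place of
          Cauchy-Schwarz.\<close>
        also have "\<dots> = 2 * \<delta> * (2 * \<delta> * (card A' * card B') - \<delta> * (card A' * card B')) - \<delta>\<^sup>2 * (card A' * card B')"
          by (simp add: power2_eq_square algebra_simps)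
        also have "\<dots> \<le> 2 * \<delta> * (?D z * (card A' * card B') - card (G \<inter> A' \<times> B')) - \<delta>\<^sup>2 * (card A' * card B')"
          using AB'(5) d \<delta> by (intro diff_right_mono mult_left_mono diff_mono mult_right_mono) auto
        also have "\<dots> = (\<Sum>x\<in>A' \<times> B'. 2 * \<delta> * (?D z - ?D' x) - \<delta>\<^sup>2)"
        proof -
          have "(\<Sum>x\<in>A' \<times> B'. 2 * \<delta> * (?D z - ?D' x) - \<delta>\<^sup>2) =
              2 * \<delta> * (\<Sum>x\<in>A' \<times> B'. ?D z - ?D' x) - (\<Sum>x\<in>A' \<times> B'. \<delta>\<^sup>2)"
            by (subst sum_subtractf) (simp only: sum_distrib_left)
          also have "(\<Sum>x\<in>A' \<times> B'. ?D z - ?D' x) = ?D z * (card A' * card B') - card (G \<inter> A' \<times> B')"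
            by (subst sum_subtractf) (simp add: sD' card_cartesian_product mult.commute)
          also have "(\<Sum>x\<in>A' \<times> B'. \<delta>\<^sup>2) = \<delta>\<^sup>2 * (card A' * card B')"
            by (simp add: card_cartesian_product mult.commute)
          finally show ?thesis by (rule sym)
        qed
        also have "\<dots> \<le> (\<Sum>x\<in>A' \<times> B'. h x)"
        proof (rule sum_mono)
          fix x assume "x \<in> A' \<times> B'"
          have "0 \<le> (?D z - ?D' x - \<delta>)\<^sup>2" by simp
          then show "2 * \<delta> * (?D z - ?D' x) - \<delta>\<^sup>2 \<le> h x"
            unfolding h_def Dz[OF \<open>x \<in> A' \<times> B'\<close>] by (simp add: power2_eq_square algebra_simps)
        qed
        also have "\<dots> \<le> sum h ?cell"
          unfolding cell using AB'(1,2) fin by (intro sum_mono2) (auto simp: h_def)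
        finally show ?thesis .
      qed
    qed
    also have "\<dots> = (\<Sum>x\<in>?\<Omega>. h x)" by (rule sum.image_gen[OF fO, symmetric])
    finally show ?thesis .
  qed
  ultimately have "energy V G F + \<delta> ^ 4 * card ?I \<le> energy V G F'" by simp
  moreover have "F \<subseteq> F'" by (simp add: F'_def)
  ultimately show ?thesis using cF' fF' by blast
qed

text \<open>Each refinement made while there are too many irregular edges raises the energy by at
  least \<open>\<delta> ^ 4 * \<gamma>\<close> times the square of \<open>card V\<close>, and the
  energy never exceeds that square. The number of rounds, and with it \<open>K\<close>, depends on
  \<delta>, \<gamma> and \<open>k0\<close> only.\<close>

lemma regular_refinement:
  fixes \<delta> \<gamma> :: real
  assumes \<delta>: "0 < \<delta>" and \<gamma>: "0 < \<gamma>"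
  shows "\<exists>K. \<forall>(V :: 'v set) G F0. finite V \<longrightarrow> G \<subseteq> V \<times> V \<longrightarrow> finite F0 \<longrightarrow> card F0 \<le> k0 \<longrightarrow>
     (\<exists>F. F0 \<subseteq> F \<and> finite F \<and> card F \<le> K \<and> card (irregular_edges \<delta> V G F) \<le> \<gamma> * (real (card V))\<^sup>2)"
proof -
  define g :: "nat \<Rightarrow> nat" where "g k = k + 2 * (2 ^ k)\<^sup>2" for k
  have mono: "g a \<le> g b" if "a \<le> b" for a b
    unfolding g_def using that by (intro add_mono mult_left_mono power_mono power_increasing) auto
  have ge: "k \<le> (g ^^ n) k" for n k
    by (induction n) (auto simp: g_def intro: le_trans)
  \<comment> \<open>The energy hypothesis leaves room for at most \<open>n\<close> further
    increments; for \<open>n = 0\<close> there are no irregular edges left.\<close>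
  have step: "\<exists>F'. F \<subseteq> F' \<and> finite F' \<and> card F' \<le> (g ^^ n) k \<and>
       card (irregular_edges \<delta> V G F') \<le> \<gamma> * (real (card V))\<^sup>2"
    if "finite V" "G \<subseteq> V \<times> V" "finite F" "card F \<le> k"
      "(real (card V))\<^sup>2 * (1 - n * (\<delta> ^ 4 * \<gamma>)) \<le> energy V G F"
    for V :: "'v set" and G F k n
    using that
  proof (induction n arbitrary: F k)
    case 0
    obtain F' where "energy V G F + \<delta> ^ 4 * card (irregular_edges \<delta> V G F) \<le> energy V G F'"
      using energy_increment[OF 0(1,2,3) \<delta>] by blast
    moreover have "energy V G F' \<le> (real (card V))\<^sup>2" by (rule energy_le[OF 0(1)])
    ultimately have "\<delta> ^ 4 * card (irregular_edges \<delta> V G F) \<le> 0" using 0(5) by simp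
    then have "card (irregular_edges \<delta> V G F) = 0" using \<delta> by (simp add: mult_le_0_iff)
    then show ?case using 0 \<gamma> by (intro exI[of _ F]) simp
  next
    case (Suc n)
    show ?case
    proof (cases "card (irregular_edges \<delta> V G F) \<le> \<gamma> * (real (card V))\<^sup>2")
      case True
      then show ?thesis using Suc.prems ge[of k "Suc n"] by (meson le_trans order_refl)
    next
      case False
      obtain F1 where F1: "F \<subseteq> F1" "finite F1" "card F1 \<le> card F + 2 * (2 ^ card F)\<^sup>2"
        "energy V G F + \<delta> ^ 4 * card (irregular_edges \<delta> V G F) \<le> energy V G F1"
        using energy_increment[OF Suc.prems(1,2,3) \<delta>] by blast
      have "card F1 \<le> g k" using F1(3) mono[OF Suc.prems(4)] by (simp add: g_def)
      moreover have "(real (card V))\<^sup>2 * (1 - n * (\<delta> ^ 4 * \<gamma>)) \<le> energy V G F1"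
      proof -
        have "\<delta> ^ 4 * (\<gamma> * (real (card V))\<^sup>2) \<le> \<delta> ^ 4 * card (irregular_edges \<delta> V G F)"
          using False \<delta> by (intro mult_left_mono) auto
        with F1(4) Suc.prems(5) show ?thesis by (simp add: algebra_simps)
      qed
      ultimately obtain F' where F': "F1 \<subseteq> F'" "finite F'" "card F' \<le> (g ^^ n) (g k)"
          "card (irregular_edges \<delta> V G F') \<le> \<gamma> * (real (card V))\<^sup>2"
        using Suc.IH[OF Suc.prems(1,2) F1(2)] by blast
      have "(g ^^ n) (g k) = (g ^^ Suc n) k" by (simp add: funpow_swap1)
      then show ?thesis using F' F1(1) by (metis order.trans)
    qed
  qed
  obtain n :: nat where n: "1 / (\<delta> ^ 4 * \<gamma>) \<le> n" using real_arch_simple by blast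
  have "0 < \<delta> ^ 4 * \<gamma>" using \<delta> \<gamma> by simp
  then have n1: "1 - n * (\<delta> ^ 4 * \<gamma>) \<le> 0" using n by (simp add: divide_le_eq)
  show ?thesis
  proof (intro exI[of _ "(g ^^ n) k0"] allI impI)
    fix V :: "'v set" and G and F0 :: "'v set set"
    assume *: "finite V" "G \<subseteq> V \<times> V" "finite F0" "card F0 \<le> k0"
    have "(real (card V))\<^sup>2 * (1 - n * (\<delta> ^ 4 * \<gamma>)) \<le> 0"
      using n1 by (intro mult_nonneg_nonpos) auto
    then have "(real (card V))\<^sup>2 * (1 - n * (\<delta> ^ 4 * \<gamma>)) \<le> energy V G F0"
      by (rule order_trans[OF _ energy_nonneg])
    then show "\<exists>F. F0 \<subseteq> F \<and> finite F \<and> card F \<le> (g ^^ n) k0 \<and>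
        card (irregular_edges \<delta> V G F) \<le> \<gamma> * (real (card V))\<^sup>2"
      by (rule step[OF *])
  qed
qed

section \<open>Large, dense and regular cells\<close>

lemma card_small_atoms:
  fixes s :: real
  assumes "finite V" "finite F" "0 \<le> s"
  shows "card {v \<in> V. card (atom V F v) < s} \<le> 2 ^ card F * s"
proof -
  let ?S = "{v \<in> V. card (atom V F v) < s}"
  have fS: "finite ?S" using assms(1) by simp
  have "real (card ?S) = (\<Sum>v\<in>?S. 1)" by simp
  also have "\<dots> = (\<Sum>A\<in>atom V F ` ?S. \<Sum>v | v \<in> ?S \<and> atom V F v = A. 1)"
    by (rule sum.image_gen[OF fS])
  also have "\<dots> \<le> (\<Sum>A\<in>atom V F ` ?S. s)"
  proof (rule sum_mono)
    fix A assume "A \<in> atom V F ` ?S"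
    then have A: "card A < s" "finite A"
      using finite_subset[OF atom_subset assms(1)] by auto
    have "card {v. v \<in> ?S \<and> atom V F v = A} \<le> card A"
      using atom_self by (intro card_mono A) force
    then show "(\<Sum>v | v \<in> ?S \<and> atom V F v = A. 1) \<le> s" using A(1) by simp
  qed
  also have "\<dots> = card (atom V F ` ?S) * s" by simp
  also have "\<dots> \<le> 2 ^ card F * s"
  proof -
    have "card (atom V F ` ?S) \<le> card (atom V F ` V)"
      using card_atoms(2)[OF assms(2)] by (intro card_mono) auto
    then have "card (atom V F ` ?S) \<le> 2 ^ card F" using card_atoms(1)[OF assms(2), of V] by linarith
    then show ?thesis using assms(3) by (intro mult_right_mono) (simp_all flip: of_nat_le_iff)
  qed
  finally show ?thesis .
qed

text \<open>By averaging, the number of edges in sparse cells is the sum of the cell densities over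
  all pairs in these cells, each less than \<beta>.\<close>

lemma card_sparse_edges:
  fixes \<beta> :: real
  assumes V: "finite V" and G: "G \<subseteq> V \<times> V" and "0 \<le> \<beta>"
  shows "card {x \<in> G. cell_dens V G F x < \<beta>} \<le> \<beta> * (real (card V))\<^sup>2"
proof -
  let ?\<Omega> = "V \<times> V" and ?D = "cell_dens V G F"
  have fO: "finite ?\<Omega>" using V by simp
  have "card {x \<in> G. ?D x < \<beta>} = (\<Sum>x\<in>?\<Omega>. of_bool (x \<in> {x \<in> G. ?D x < \<beta>}) * (1 :: real))"
    using G by (subst sum_of_bool_mult[OF fO]) auto
  also have "\<dots> = (\<Sum>x\<in>?\<Omega>. of_bool (?D x < \<beta>) * of_bool (x \<in> G))"
    by (intro sum.cong) auto
  also have "\<dots> = (\<Sum>x\<in>?\<Omega>. of_bool (?D x < \<beta>) * ?D x)"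
    unfolding cell_dens_def by (intro sum_mult_avg[symmetric] fO) (simp cong: avg_cong)
  also have "\<dots> \<le> (\<Sum>x\<in>?\<Omega>. \<beta>)" using \<open>0 \<le> \<beta>\<close> by (intro sum_mono) auto
  also have "\<dots> = \<beta> * (real (card V))\<^sup>2" by (simp add: card_cartesian_product power2_eq_square)
  finally show ?thesis .
qed

definition good_pair :: "real \<Rightarrow> real \<Rightarrow> ('v \<times> 'v) set \<Rightarrow> 'v set \<Rightarrow> 'v set \<Rightarrow> bool" where
  "good_pair \<delta> s G A B \<longleftrightarrow> s \<le> card A \<and> s \<le> card B \<and> lower_regular \<delta> G A B"

text \<open>Of the bound, one \<delta> accounts for each endpoint in a small cell,
  \<open>2 * \<delta>\<close> for the sparse cells and \<delta> for the irregular ones. The family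
  \<open>F0\<close> lets the cells respect prescribed sets.\<close>

lemma regular_cells:
  fixes \<delta> :: real
  assumes \<delta>: "0 < \<delta>"
  shows "\<exists>\<tau> :: real. \<tau> > 0 \<and> (\<forall>(V :: 'v set) G F0. finite V \<longrightarrow> G \<subseteq> V \<times> V \<longrightarrow> finite F0 \<longrightarrow> card F0 \<le> k0 \<longrightarrow>
     (\<exists>cell. (\<forall>v\<in>V. v \<in> cell v \<and> cell v \<subseteq> V \<and> (\<forall>W\<in>F0. v \<in> W \<longrightarrow> cell v \<subseteq> W)) \<and>
       card {x \<in> G. \<not> good_pair \<delta> (\<tau> * card V) G (cell (fst x)) (cell (snd x))} \<le> 5 * \<delta> * (real (card V))\<^sup>2))"
proof -
  obtain K where K: "\<And>(V :: 'v set) G F0. finite V \<Longrightarrow> G \<subseteq> V \<times> V \<Longrightarrow> finite F0 \<Longrightarrow> card F0 \<le> k0 \<Longrightarrow>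
     \<exists>F. F0 \<subseteq> F \<and> finite F \<and> card F \<le> K \<and> card (irregular_edges \<delta> V G F) \<le> \<delta> * (real (card V))\<^sup>2"
    using regular_refinement[OF \<delta> \<delta>, of k0, where 'v = 'v] by blast
  define \<tau> where "\<tau> = \<delta> / 2 ^ K"
  have "\<tau> > 0" using \<delta> by (simp add: \<tau>_def)
  have main: "\<exists>cell. (\<forall>v\<in>V. v \<in> cell v \<and> cell v \<subseteq> V \<and> (\<forall>W\<in>F0. v \<in> W \<longrightarrow> cell v \<subseteq> W)) \<and>
       card {x \<in> G. \<not> good_pair \<delta> (\<tau> * card V) G (cell (fst x)) (cell (snd x))} \<le> 5 * \<delta> * (real (card V))\<^sup>2"
    if V: "finite V" and G: "G \<subseteq> V \<times> V" and F0: "finite F0" "card F0 \<le> k0" for V :: "'v set" and G F0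
  proof -
    obtain F where F: "F0 \<subseteq> F" "finite F" "card F \<le> K"
      "card (irregular_edges \<delta> V G F) \<le> \<delta> * (real (card V))\<^sup>2"
      using K[OF V G F0] by blast
    define S where "S = {v \<in> V. card (atom V F v) < \<tau> * card V}"
    have "card S \<le> 2 ^ card F * (\<tau> * card V)"
      unfolding S_def using V F(2) \<open>\<tau> > 0\<close> by (intro card_small_atoms) auto
    also have "\<dots> \<le> 2 ^ K * (\<tau> * card V)"
      using F(3) \<open>\<tau> > 0\<close> by (intro mult_right_mono power_increasing) auto
    also have "\<dots> = \<delta> * card V" by (simp add: \<tau>_def)
    finally have cS: "card S * real (card V) \<le> \<delta> * (real (card V))\<^sup>2"
      using mult_right_mono[of "real (card S)" "\<delta> * card V" "real (card V)"]
      by (simp add: power2_eq_square mult.assoc)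
    let ?bad = "{x \<in> G. \<not> good_pair \<delta> (\<tau> * card V) G (atom V F (fst x)) (atom V F (snd x))}"
    let ?low = "{x \<in> G. cell_dens V G F x < 2 * \<delta>}"
    have "?bad \<subseteq> S \<times> V \<union> V \<times> S \<union> ?low \<union> irregular_edges \<delta> V G F"
      using G by (auto simp: good_pair_def S_def irregular_edges_def not_le not_less)
    then have "card ?bad \<le> card (S \<times> V \<union> V \<times> S \<union> ?low \<union> irregular_edges \<delta> V G F)"
      using V finite_subset[OF G] by (intro card_mono) (auto simp: S_def irregular_edges_def)
    also have "\<dots> \<le> card (S \<times> V) + card (V \<times> S) + card ?low + card (irregular_edges \<delta> V G F)"
      by (meson add_mono card_Un_le le_trans order_refl)
    finally have "real (card ?bad) \<le> real (card (S \<times> V) + card (V \<times> S) + card ?low + card (irregular_edges \<delta> V G F))"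
      by (rule of_nat_mono)
    also have "\<dots> = card S * real (card V) + card S * real (card V) + card ?low + card (irregular_edges \<delta> V G F)"
      unfolding card_cartesian_product of_nat_add of_nat_mult by (simp only: mult.commute)
    also have "\<dots> \<le> 5 * \<delta> * (real (card V))\<^sup>2"
      using cS F(4) card_sparse_edges[OF V G, of "2 * \<delta>" F] \<delta> by simp
    finally have "card ?bad \<le> 5 * \<delta> * (real (card V))\<^sup>2" .
    moreover have "v \<in> atom V F v \<and> atom V F v \<subseteq> V \<and> (\<forall>W\<in>F0. v \<in> W \<longrightarrow> atom V F v \<subseteq> W)" if "v \<in> V" for v
      using that F(1) by (auto simp: atom_def)
    ultimately show ?thesis by (intro exI[of _ "atom V F"]) blast
  qed
  show ?thesis by (intro exI[of _ \<tau>] conjI allI impI \<open>\<tau> > 0\<close> main)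
qed

section \<open>Degrees in lower regular pairs\<close>

lemma lower_regular_converse:
  assumes "lower_regular \<delta> E A B"
  shows "lower_regular \<delta> (E\<inverse>) B A"
  unfolding lower_regular_def
proof (intro allI impI)
  fix B' A' assume "B' \<subseteq> B" "A' \<subseteq> A" "\<delta> * card B \<le> card B'" "\<delta> * card A \<le> card A'"
  then have "\<delta> * (card A' * card B') \<le> card (E \<inter> A' \<times> B')"
    using assms unfolding lower_regular_def by simp
  also have "card (E \<inter> A' \<times> B') = card ((E \<inter> A' \<times> B')\<inverse>)" by simp
  also have "(E \<inter> A' \<times> B')\<inverse> = E\<inverse> \<inter> B' \<times> A'" by blast
  finally show "\<delta> * (card B' * card A') \<le> card (E\<inverse> \<inter> B' \<times> A')" by (simp only: mult.commute)
qed

text \<open>Otherwise the vertices of low degree and \<open>B'\<close> form a large rectangle of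
  density below \<delta>.\<close>

lemma lower_regular_low_degrees:
  fixes \<delta> :: real
  assumes reg: "lower_regular \<delta> E A B" and fin: "finite A" "finite B" and A: "A \<noteq> {}" and \<delta>: "0 < \<delta>"
    and B': "B' \<subseteq> B" "\<delta> * card B \<le> card B'"
  shows "card {a \<in> A. card {b \<in> B'. (a, b) \<in> E} < \<delta> * card B'} < \<delta> * card A"
proof (rule ccontr)
  let ?A' = "{a \<in> A. card {b \<in> B'. (a, b) \<in> E} < \<delta> * card B'}"
  assume "\<not> ?thesis"
  then have large: "\<delta> * card A \<le> card ?A'" by simp
  have "0 < \<delta> * card A" using A fin(1) \<delta> by (simp add: card_gt_0_iff)
  with large have ne: "?A' \<noteq> {}" by force
  have f: "finite ?A'" "finite B'" using fin B' finite_subset by auto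
  have "\<delta> * (card ?A' * card B') \<le> card (E \<inter> ?A' \<times> B')"
    using reg[unfolded lower_regular_def, rule_format, of ?A' B'] large B' by simp
  also have "real (card (E \<inter> ?A' \<times> B')) = (\<Sum>a\<in>?A'. real (card {b \<in> B'. (a, b) \<in> E}))"
  proof -
    have "E \<inter> ?A' \<times> B' = (SIGMA a:?A'. {b \<in> B'. (a, b) \<in> E})" by blast
    then show ?thesis using f by (simp only: card_SigmaI finite_Collect_conjI of_nat_sum) simp
  qed
  also have "\<dots> < (\<Sum>a\<in>?A'. \<delta> * card B')"
    by (rule sum_strict_mono[OF f(1) ne]) simp
  also have "\<dots> = \<delta> * (card ?A' * card B')" by simp
  finally show False by simp
qed

text \<open>The vertices of low degree to either side make up less than the fraction \<delta> of
  \<open>A\<close> each, and \<delta> is at most one half.\<close>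

lemma ex_common_high_degree:
  fixes \<delta> :: real
  assumes r1: "lower_regular \<delta> E A B" and r2: "lower_regular \<delta> E' C A"
    and fin: "finite A" "finite B" "finite C" and A: "A \<noteq> {}" and \<delta>: "0 < \<delta>" "\<delta> \<le> 1 / 2"
    and B': "B' \<subseteq> B" "\<delta> * card B \<le> card B'" and C': "C' \<subseteq> C" "\<delta> * card C \<le> card C'"
  shows "\<exists>a\<in>A. \<delta> * card B' \<le> card {b \<in> B'. (a, b) \<in> E} \<and> \<delta> * card C' \<le> card {c \<in> C'. (c, a) \<in> E'}"
proof (rule ccontr)
  let ?S = "{a \<in> A. card {b \<in> B'. (a, b) \<in> E} < \<delta> * card B'}"
  let ?T = "{a \<in> A. card {c \<in> C'. (a, c) \<in> E'\<inverse>} < \<delta> * card C'}"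
  assume "\<not> ?thesis"
  then have "A \<subseteq> ?S \<union> ?T" by (auto simp: not_le)
  then have "card A \<le> card (?S \<union> ?T)" using fin(1) by (intro card_mono) auto
  also have "\<dots> \<le> card ?S + card ?T" by (rule card_Un_le)
  finally have "real (card A) \<le> card ?S + card ?T" by (simp flip: of_nat_add of_nat_le_iff)
  moreover have "card ?S < \<delta> * card A"
    by (rule lower_regular_low_degrees[OF r1 fin(1,2) A \<delta>(1) B'])
  moreover have "card ?T < \<delta> * card A"
    by (rule lower_regular_low_degrees[OF lower_regular_converse[OF r2] fin(1,3) A \<delta>(1) C'])
  moreover have "2 * \<delta> * card A \<le> card A" using mult_right_mono[of "2 * \<delta>" 1 "real (card A)"] \<delta>(2) by simp
  ultimately show False by simp
qed

section \<open>Short cycles in dense families\<close>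

text \<open>Excludes rainbow cycles of length 2 among the first \<open>l\<close> colours, so that an
  element is determined by its values under two functions.\<close>

definition agree_at_most_once :: "nat \<Rightarrow> 'a set \<Rightarrow> (nat \<Rightarrow> 'a \<Rightarrow> 'b) \<Rightarrow> bool" where
  "agree_at_most_once l X F \<longleftrightarrow>
     (\<forall>x\<in>X. \<forall>y\<in>X. \<forall>k<l. \<forall>k'<l. k \<noteq> k' \<longrightarrow> F k x = F k y \<longrightarrow> F k' x = F k' y \<longrightarrow> x = y)"

lemma agree_at_most_onceD:
  "agree_at_most_once l X F \<Longrightarrow> x \<in> X \<Longrightarrow> y \<in> X \<Longrightarrow> k < l \<Longrightarrow> k' < l \<Longrightarrow> k \<noteq> k' \<Longrightarrow>
    F k x = F k y \<Longrightarrow> F k' x = F k' y \<Longrightarrow> x = y"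
  unfolding agree_at_most_once_def by blast

text \<open>Each element becomes an edge joining its values under two cyclically consecutive
  functions.\<close>

definition link :: "nat \<Rightarrow> 'a set \<Rightarrow> (nat \<Rightarrow> 'a \<Rightarrow> 'b) \<Rightarrow> nat \<Rightarrow> ('b \<times> 'b) set" where
  "link l X F k = (\<lambda>x. (F k x, F (Suc k mod l) x)) ` X"

lemma linkD: "(a, b) \<in> link l X F k \<Longrightarrow> \<exists>x\<in>X. F k x = a \<and> F (Suc k mod l) x = b"
  unfolding link_def by blast

lemma Suc_mod_neq: "2 \<le> l \<Longrightarrow> k < l \<Longrightarrow> k \<noteq> Suc k mod l" for k l :: nat
  by (cases "Suc k = l") auto

text \<open>The \<open>l\<close> graphs are regularised together, as one graph on pairs of a colour
  and a value, with the colour classes as initial family. Each bad edge rules out at most one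
  element per colour, so some element has only good edges; the cells of its values provide the sets
  \<open>A k\<close>.\<close>

lemma regular_cells_of_family:
  fixes \<epsilon> :: real and l :: nat
  assumes \<epsilon>: "0 < \<epsilon>" and l: "2 \<le> l"
  shows "\<exists>\<delta> \<tau> :: real. 0 < \<delta> \<and> \<delta> \<le> 1 / 2 \<and> 0 < \<tau> \<and>
    (\<forall>q (X :: 'a set) (F :: nat \<Rightarrow> 'a \<Rightarrow> nat). 1 \<le> q \<longrightarrow> finite X \<longrightarrow> (\<forall>k<l. \<forall>x\<in>X. F k x < q) \<longrightarrow>
       agree_at_most_once l X F \<longrightarrow> \<epsilon> * (real q)\<^sup>2 \<le> card X \<longrightarrow>
       (\<exists>A. \<forall>k<l. finite (A k) \<and> A k \<noteq> {} \<and> \<tau> * real q \<le> card (A k) \<and>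
          lower_regular \<delta> (link l X F k) (A k) (A (Suc k mod l))))"
proof -
  \<comment> \<open>With \<open>10 * l ^ 3 * \<delta> \<le> \<epsilon>\<close>, the at most
    \<open>5 * \<delta> * l ^ 3 * q\<^sup>2\<close> elements with a bad edge are at most half of
    \<open>\<epsilon> * q\<^sup>2\<close>.\<close>
  define \<delta> where "\<delta> = min (1 / 2) (\<epsilon> / (10 * real l ^ 3))"
  have \<delta>: "0 < \<delta>" "\<delta> \<le> 1 / 2" using \<epsilon> l by (auto simp: \<delta>_def)
  have "\<delta> \<le> \<epsilon> / (10 * real l ^ 3)" by (simp add: \<delta>_def)
  then have \<delta>\<epsilon>: "10 * real l ^ 3 * \<delta> \<le> \<epsilon>" using l by (simp add: le_divide_eq mult.commute)
  obtain \<tau> :: real where \<tau>: "\<tau> > 0" and cells: "\<And>(V :: (nat \<times> nat) set) G F0. finite V \<Longrightarrow> G \<subseteq> V \<times> V \<Longrightarrow>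
     finite F0 \<Longrightarrow> card F0 \<le> l \<Longrightarrow>
     \<exists>cell. (\<forall>v\<in>V. v \<in> cell v \<and> cell v \<subseteq> V \<and> (\<forall>W\<in>F0. v \<in> W \<longrightarrow> cell v \<subseteq> W)) \<and>
       card {x \<in> G. \<not> good_pair \<delta> (\<tau> * card V) G (cell (fst x)) (cell (snd x))} \<le> 5 * \<delta> * (real (card V))\<^sup>2"
    using regular_cells[OF \<delta>(1), of l, where 'v = "nat \<times> nat"] by blast
  have main: "\<exists>A. \<forall>k<l. finite (A k) \<and> A k \<noteq> {} \<and> \<tau> * real q \<le> card (A k) \<and>
          lower_regular \<delta> (link l X F k) (A k) (A (Suc k mod l))"
    if q: "1 \<le> q" and X: "finite X" and F: "\<forall>k<l. \<forall>x\<in>X. F k x < q"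
      and once: "agree_at_most_once l X F" and large: "\<epsilon> * (real q)\<^sup>2 \<le> card X"
    for q and X :: "'a set" and F :: "nat \<Rightarrow> 'a \<Rightarrow> nat"
  proof -
    define V where "V = {..<l} \<times> {..<q}"
    define edge where "edge k x = ((k, F k x), (Suc k mod l, F (Suc k mod l) x))" for k x
    define G where "G = (\<Union>k<l. edge k ` X)"
    have sk: "Suc k mod l < l" for k using l by simp
    have V: "finite V" "card V = l * q" by (simp_all add: V_def card_cartesian_product)
    have G: "G \<subseteq> V \<times> V" using F sk by (auto simp: G_def V_def edge_def)
    have fin: "finite ((\<lambda>k. {k} \<times> (UNIV :: nat set)) ` {..<l})" by simp
    have "card ((\<lambda>k. {k} \<times> (UNIV :: nat set)) ` {..<l}) \<le> l"
      using card_image_le[of "{..<l}"] by simp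
    from cells[OF V(1) G fin this] obtain cell where
      cell: "\<forall>v\<in>V. v \<in> cell v \<and> cell v \<subseteq> V \<and> (\<forall>W\<in>(\<lambda>k. {k} \<times> UNIV) ` {..<l}. v \<in> W \<longrightarrow> cell v \<subseteq> W)"
      and bad: "card {x \<in> G. \<not> good_pair \<delta> (\<tau> * card V) G (cell (fst x)) (cell (snd x))} \<le> 5 * \<delta> * (real (card V))\<^sup>2"
      by (elim exE conjE)
    define B where "B = {x \<in> G. \<not> good_pair \<delta> (\<tau> * card V) G (cell (fst x)) (cell (snd x))}"
    have "finite G" using X by (simp add: G_def)
    then have fB: "finite B" by (simp add: B_def)
    have cB: "card {x \<in> X. edge k x \<in> B} \<le> card B" if k: "k < l" for k
    proof (rule card_inj_on_le[of "edge k"])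
      show "inj_on (edge k) {x \<in> X. edge k x \<in> B}"
        using agree_at_most_onceD[OF once _ _ k sk Suc_mod_neq[OF l k]]
        by (auto simp: inj_on_def edge_def)
    qed (use fB in auto)
    have "\<exists>x\<in>X. \<forall>k<l. edge k x \<notin> B"
    proof (rule ccontr)
      assume "\<not> ?thesis"
      then have "X \<subseteq> (\<Union>k<l. {x \<in> X. edge k x \<in> B})" by auto
      then have "card X \<le> card (\<Union>k<l. {x \<in> X. edge k x \<in> B})" using X by (intro card_mono) auto
      also have "\<dots> \<le> (\<Sum>k<l. card {x \<in> X. edge k x \<in> B})" by (rule card_UN_le) simp
      also have "\<dots> \<le> (\<Sum>k<l. card B)" using cB by (intro sum_mono) simp
      finally have "card X \<le> l * card B" by simp
      then have "real (card X) \<le> real l * card B" by (simp flip: of_nat_mult)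
      also have "\<dots> \<le> real l * (5 * \<delta> * (real l * real q)\<^sup>2)"
        using bad V(2) by (intro mult_left_mono) (simp_all add: B_def)
      also have "\<dots> = (10 * real l ^ 3 * \<delta>) * ((real q)\<^sup>2 / 2)"
        by (simp add: power2_eq_square power3_eq_cube)
      also have "\<dots> \<le> \<epsilon> * ((real q)\<^sup>2 / 2)" using \<delta>\<epsilon> by (intro mult_right_mono) auto
      also have "\<dots> < \<epsilon> * (real q)\<^sup>2" using \<epsilon> q by simp
      finally show False using large by simp
    qed
    then obtain x where x: "x \<in> X" "\<And>k. k < l \<Longrightarrow> edge k x \<notin> B" by blast
    define A where "A k = snd ` cell (k, F k x)" for k
    have vV: "(k, F k x) \<in> V" if "k < l" for k using that F x(1) by (simp add: V_def)
    have cellA: "cell (k, F k x) = {k} \<times> A k" if "k < l" for k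
    proof -
      have "cell (k, F k x) \<subseteq> {k} \<times> UNIV" using bspec[OF cell vV[OF that]] that by blast
      then show ?thesis by (force simp: A_def)
    qed
    have fA: "finite (A k)" if "k < l" for k
      using bspec[OF cell vV[OF that]] V(1) by (auto simp: A_def intro: finite_subset)
    have good: "good_pair \<delta> (\<tau> * card V) G ({k} \<times> A k) ({Suc k mod l} \<times> A (Suc k mod l))" if k: "k < l" for k
    proof -
      have "edge k x \<in> G" using x(1) k by (auto simp: G_def)
      with x(2)[OF k] have "good_pair \<delta> (\<tau> * card V) G (cell (fst (edge k x))) (cell (snd (edge k x)))"
        by (simp add: B_def)
      then show ?thesis by (simp add: edge_def cellA k sk)
    qed
    have "finite (A k) \<and> A k \<noteq> {} \<and> \<tau> * real q \<le> card (A k) \<and>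
          lower_regular \<delta> (link l X F k) (A k) (A (Suc k mod l))" if k: "k < l" for k
    proof (intro conjI fA k)
      show "A k \<noteq> {}" using bspec[OF cell vV[OF k]] by (auto simp: A_def)
      have "q \<le> card V" using l V(2) by simp
      then have "\<tau> * real q \<le> \<tau> * card V" using \<tau> by (intro mult_left_mono) simp_all
      also have "\<dots> \<le> card ({k} \<times> A k)" using good[OF k] unfolding good_pair_def by (elim conjE)
      also have "card ({k} \<times> A k) = card (A k)" by (simp add: card_cartesian_product)
      finally show "\<tau> * real q \<le> card (A k)" .
      show "lower_regular \<delta> (link l X F k) (A k) (A (Suc k mod l))"
        unfolding lower_regular_def
      proof (intro allI impI)
        fix A' B' assume *: "A' \<subseteq> A k" "B' \<subseteq> A (Suc k mod l)" "\<delta> * card (A k) \<le> card A'"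
          "\<delta> * card (A (Suc k mod l)) \<le> card B'"
        have "lower_regular \<delta> G ({k} \<times> A k) ({Suc k mod l} \<times> A (Suc k mod l))"
          using good[OF k] unfolding good_pair_def by (elim conjE)
        then have "\<delta> * (card ({k} \<times> A') * card ({Suc k mod l} \<times> B')) \<le>
            card (G \<inter> ({k} \<times> A') \<times> ({Suc k mod l} \<times> B'))"
          by (rule lower_regular_def[THEN iffD1, rule_format]) (use * in \<open>auto simp: card_cartesian_product\<close>)
        \<comment> \<open>The colour of the first endpoint determines \<open>k\<close>, so these
          edges all come from the \<open>k\<close>-th graph.\<close>
        also have "G \<inter> ({k} \<times> A') \<times> ({Suc k mod l} \<times> B') \<subseteq>
            (\<lambda>(a, b). ((k, a), (Suc k mod l, b))) ` (link l X F k \<inter> A' \<times> B')"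
          by (auto simp: G_def edge_def link_def)
        then have "card (G \<inter> ({k} \<times> A') \<times> ({Suc k mod l} \<times> B')) \<le> card (link l X F k \<inter> A' \<times> B')"
          using X by (intro surj_card_le) (auto simp: link_def)
        finally show "\<delta> * (card A' * card B') \<le> card (link l X F k \<inter> A' \<times> B')"
          by (simp add: card_cartesian_product)
      qed
    qed
    then show ?thesis by blast
  qed
  show ?thesis
    by (intro exI[of _ \<delta>] exI[of _ \<tau>] conjI allI impI \<delta> \<tau>) (rule main)
qed

section \<open>Triangles and quadrilaterals\<close>

definition cycle_seed :: "nat \<Rightarrow> 'a set \<Rightarrow> (nat \<Rightarrow> 'a \<Rightarrow> 'b) \<Rightarrow> bool" where
  "cycle_seed l X F \<longleftrightarrow>
     (\<exists>v. inj_on v {..<l} \<and> v ` {..<l} \<subseteq> X \<and> (\<forall>i<l. F i (v i) = F i (v (Suc i mod l))))"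

text \<open>Choose \<open>a\<close> with many neighbours in both other cells. Lower regularity gives
  more than \<open>q\<close> edges between the two neighbourhoods, of which at most \<open>q\<close>
  come from elements that themselves take the value \<open>a\<close>. Any other edge completes a
  triangle with three distinct elements.\<close>

lemma ex_triangle:
  fixes \<epsilon> :: real
  assumes \<epsilon>: "0 < \<epsilon>"
  shows "\<exists>q0. \<forall>q\<ge>q0. \<forall>(X :: 'a set) (F :: nat \<Rightarrow> 'a \<Rightarrow> nat). finite X \<longrightarrow> (\<forall>k<3. \<forall>x\<in>X. F k x < q) \<longrightarrow>
    agree_at_most_once 3 X F \<longrightarrow> \<epsilon> * (real q)\<^sup>2 \<le> card X \<longrightarrow> cycle_seed 3 X F"
proof -
  obtain \<delta> \<tau> :: real where \<delta>: "0 < \<delta>" "\<delta> \<le> 1 / 2" and \<tau>: "0 < \<tau>" and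
    cells: "\<And>q (X :: 'a set) (F :: nat \<Rightarrow> 'a \<Rightarrow> nat). 1 \<le> q \<Longrightarrow> finite X \<Longrightarrow> \<forall>k<3. \<forall>x\<in>X. F k x < q \<Longrightarrow>
       agree_at_most_once 3 X F \<Longrightarrow> \<epsilon> * (real q)\<^sup>2 \<le> card X \<Longrightarrow>
       \<exists>A. \<forall>k<3. finite (A k) \<and> A k \<noteq> {} \<and> \<tau> * real q \<le> card (A k) \<and>
          lower_regular \<delta> (link 3 X F k) (A k) (A (Suc k mod 3))"
    using regular_cells_of_family[OF \<epsilon>, of 3, where 'a = 'a] by auto
  \<comment> \<open>Chosen so that \<open>\<delta> ^ 3 * \<tau>\<^sup>2 * q\<^sup>2\<close>, the
    lower bound on the number of these edges, exceeds \<open>q\<close>.\<close>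
  obtain q1 :: nat where q1: "1 / (\<delta> ^ 3 * \<tau>\<^sup>2) < q1" using reals_Archimedean2 by blast
  have main: "cycle_seed 3 X F" if q: "Suc q1 \<le> q" and X: "finite X" and F: "\<forall>k<3. \<forall>x\<in>X. F k x < q"
      and once: "agree_at_most_once 3 X F" and large: "\<epsilon> * (real q)\<^sup>2 \<le> card X"
    for q and X :: "'a set" and F :: "nat \<Rightarrow> 'a \<Rightarrow> nat"
  proof -
    have "1 \<le> q" using q by simp
    from cells[OF this X F once large] obtain A where A: "\<And>k. k < 3 \<Longrightarrow> finite (A k)" "\<And>k. k < 3 \<Longrightarrow> A k \<noteq> {}"
      "\<And>k. k < 3 \<Longrightarrow> \<tau> * real q \<le> card (A k)"
      "\<And>k. k < 3 \<Longrightarrow> lower_regular \<delta> (link 3 X F k) (A k) (A (Suc k mod 3))" by blast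
    have reg: "lower_regular \<delta> (link 3 X F 0) (A 0) (A 1)" "lower_regular \<delta> (link 3 X F 1) (A 1) (A 2)"
      "lower_regular \<delta> (link 3 X F 2) (A 2) (A 0)"
      using A(4)[of 0] A(4)[of 1] A(4)[of 2] by (simp_all add: numeral_2_eq_2)
    have "\<delta> * card (A k) \<le> card (A k)" for k
      using \<delta> mult_right_mono[of \<delta> 1 "card (A k)"] by simp
    then obtain a where a: "a \<in> A 0" "\<delta> * card (A 1) \<le> card {b \<in> A 1. (a, b) \<in> link 3 X F 0}"
      "\<delta> * card (A 2) \<le> card {c \<in> A 2. (c, a) \<in> link 3 X F 2}"
      using ex_common_high_degree[OF reg(1,3) A(1) A(1) A(1) A(2) \<delta>, of "A 1" "A 2"] by auto
    define N1 where "N1 = {b \<in> A 1. (a, b) \<in> link 3 X F 0}"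
    define N2 where "N2 = {c \<in> A 2. (c, a) \<in> link 3 X F 2}"
    define P where "P = link 3 X F 1 \<inter> N1 \<times> N2"
    define Q where "Q = {x \<in> X. F 0 x = a}"
    have N: "\<delta> * (\<tau> * q) \<le> card N1" "\<delta> * (\<tau> * q) \<le> card N2"
    proof -
      have "\<delta> * (\<tau> * q) \<le> \<delta> * card (A 1)" "\<delta> * (\<tau> * q) \<le> \<delta> * card (A 2)"
        using A(3)[of 1] A(3)[of 2] \<delta>(1) by (auto intro!: mult_left_mono)
      with a(2,3) show "\<delta> * (\<tau> * q) \<le> card N1" "\<delta> * (\<tau> * q) \<le> card N2"
        unfolding N1_def N2_def by (auto intro: order_trans)
    qed
    have "card Q \<le> card {..<q}"
    proof (rule card_inj_on_le[of "F 1"])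
      show "inj_on (F 1) Q"
        using agree_at_most_onceD[OF once, of _ _ 0 1] by (auto simp: inj_on_def Q_def)
      show "F 1 ` Q \<subseteq> {..<q}" using F by (auto simp: Q_def)
    qed simp
    have "1 < \<delta> ^ 3 * \<tau>\<^sup>2 * q"
    proof -
      have "1 / (\<delta> ^ 3 * \<tau>\<^sup>2) < q" using q1 q by linarith
      then show ?thesis using \<delta> \<tau> by (simp add: divide_less_eq mult.commute)
    qed
    then have "real q < \<delta> ^ 3 * \<tau>\<^sup>2 * q * q"
      using mult_strict_right_mono[of 1 "\<delta> ^ 3 * \<tau>\<^sup>2 * q" "real q"] \<open>1 \<le> q\<close> by simp
    also have "\<dots> = \<delta> * ((\<delta> * (\<tau> * q)) * (\<delta> * (\<tau> * q)))"
      by (simp add: power2_eq_square power3_eq_cube)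
    also have "\<dots> \<le> \<delta> * (card N1 * card N2)"
      using N \<delta> \<tau> unfolding of_nat_mult by (intro mult_left_mono mult_mono) auto
    also have "\<dots> \<le> card P"
      unfolding P_def using reg(2)[unfolded lower_regular_def, rule_format, of N1 N2] a(2,3)
      by (simp add: N1_def N2_def)
    finally have "q < card P" by simp
    then have "card ((\<lambda>x. (F 1 x, F 2 x)) ` Q) < card P"
      using card_image_le[of Q "\<lambda>x. (F 1 x, F 2 x)"] \<open>card Q \<le> card {..<q}\<close> X by (simp add: Q_def)
    then have "\<not> P \<subseteq> (\<lambda>x. (F 1 x, F 2 x)) ` Q"
      using X card_mono[of "(\<lambda>x. (F 1 x, F 2 x)) ` Q" P] by (auto simp: Q_def)
    then obtain p where p: "p \<in> P" "p \<notin> (\<lambda>x. (F 1 x, F 2 x)) ` Q" by blast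
    then obtain y where y: "y \<in> X" "p = (F 1 y, F 2 y)" "F 0 y \<noteq> a"
      by (auto simp: P_def link_def Q_def numeral_2_eq_2)
    have "(a, F 1 y) \<in> link 3 X F 0" "(F 2 y, a) \<in> link 3 X F 2"
      using p(1) y(2) by (auto simp: P_def N1_def N2_def)
    then obtain z w where z: "z \<in> X" "F 0 z = a" "F 1 z = F 1 y" and w: "w \<in> X" "F 2 w = F 2 y" "F 0 w = a"
      by (auto simp: link_def)
    have "y \<noteq> z" "y \<noteq> w" using y z w by auto
    \<comment> \<open>If \<open>z = w\<close>, this element would agree with \<open>y\<close> under
      both \<open>F 1\<close> and \<open>F 2\<close>.\<close>
    have "z \<noteq> w"
      using agree_at_most_onceD[OF once y(1) z(1), of 1 2] z w \<open>y \<noteq> z\<close> by auto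
    define v where "v i = (if i = 0 then w else if i = 1 then z else y)" for i :: nat
    have v: "v 0 = w" "v 1 = z" "v 2 = y" by (simp_all add: v_def)
    have "{..<3} = {0, 1, 2 :: nat}" by auto
    then have "inj_on v {..<3}" "v ` {..<3} \<subseteq> X"
      using v y(1) z(1) w(1) \<open>y \<noteq> z\<close> \<open>y \<noteq> w\<close> \<open>z \<noteq> w\<close> by auto
    moreover have "F i (v i) = F i (v (Suc i mod 3))" if i: "i < 3" for i
    proof -
      have m: "Suc 0 mod 3 = (1 :: nat)" "Suc 1 mod 3 = (2 :: nat)" "Suc 2 mod 3 = (0 :: nat)" by simp_all
      have eqs: "F 0 (v 0) = F 0 (v 1)" "F 1 (v 1) = F 1 (v 2)" "F 2 (v 2) = F 2 (v 0)"
        by (simp_all only: v y z w)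
      consider "i = 0" | "i = 1" | "i = 2" using i by linarith
      then show ?thesis
      proof cases
        case 1
        show ?thesis unfolding 1 m by (rule eqs)
      next
        case 2
        show ?thesis unfolding 2 m by (rule eqs)
      next
        case 3
        show ?thesis unfolding 3 m by (rule eqs)
      qed
    qed
    ultimately show ?thesis unfolding cycle_seed_def by blast
  qed
  show ?thesis by (intro exI[of _ "Suc q1"] allI impI) (rule main)
qed

lemma ex_not_among_three:
  assumes "finite M" "4 \<le> card M"
  shows "\<exists>d\<in>M. d \<noteq> x \<and> d \<noteq> y \<and> d \<noteq> z"
proof -
  have "card {x, y, z} \<le> 3" using card_length[of "[x, y, z]"] by simp
  then have "\<not> M \<subseteq> {x, y, z}"
    using assms card_mono[of "{x, y, z}" M] by auto
  then show ?thesis by blast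
qed

text \<open>Opposite values \<open>a\<close> and \<open>c\<close> are chosen with at least four
  common neighbours in each of the other two cells. Degenerate cycles are then avoided by excluding
  at most three values for each of \<open>b\<close> and \<open>d\<close>.\<close>

lemma ex_four_cycle:
  fixes \<epsilon> :: real
  assumes \<epsilon>: "0 < \<epsilon>"
  shows "\<exists>q0. \<forall>q\<ge>q0. \<forall>(X :: 'a set) (F :: nat \<Rightarrow> 'a \<Rightarrow> nat). finite X \<longrightarrow> (\<forall>k<4. \<forall>x\<in>X. F k x < q) \<longrightarrow>
    agree_at_most_once 4 X F \<longrightarrow> \<epsilon> * (real q)\<^sup>2 \<le> card X \<longrightarrow> cycle_seed 4 X F"
proof -
  obtain \<delta> \<tau> :: real where \<delta>: "0 < \<delta>" "\<delta> \<le> 1 / 2" and \<tau>: "0 < \<tau>" and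
    cells: "\<And>q (X :: 'a set) (F :: nat \<Rightarrow> 'a \<Rightarrow> nat). 1 \<le> q \<Longrightarrow> finite X \<Longrightarrow> \<forall>k<4. \<forall>x\<in>X. F k x < q \<Longrightarrow>
       agree_at_most_once 4 X F \<Longrightarrow> \<epsilon> * (real q)\<^sup>2 \<le> card X \<Longrightarrow>
       \<exists>A. \<forall>k<4. finite (A k) \<and> A k \<noteq> {} \<and> \<tau> * real q \<le> card (A k) \<and>
          lower_regular \<delta> (link 4 X F k) (A k) (A (Suc k mod 4))"
    using regular_cells_of_family[OF \<epsilon>, of 4, where 'a = 'a] by auto
  obtain q1 :: nat where q1: "4 / (\<delta>\<^sup>2 * \<tau>) < q1" using reals_Archimedean2 by blast
  have main: "cycle_seed 4 X F" if q: "Suc q1 \<le> q" and X: "finite X" and F: "\<forall>k<4. \<forall>x\<in>X. F k x < q"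
      and once: "agree_at_most_once 4 X F" and large: "\<epsilon> * (real q)\<^sup>2 \<le> card X"
    for q and X :: "'a set" and F :: "nat \<Rightarrow> 'a \<Rightarrow> nat"
  proof -
    have "1 \<le> q" using q by simp
    from cells[OF this X F once large] obtain A where A: "\<And>k. k < 4 \<Longrightarrow> finite (A k)" "\<And>k. k < 4 \<Longrightarrow> A k \<noteq> {}"
      "\<And>k. k < 4 \<Longrightarrow> \<tau> * real q \<le> card (A k)"
      "\<And>k. k < 4 \<Longrightarrow> lower_regular \<delta> (link 4 X F k) (A k) (A (Suc k mod 4))" by blast
    have m: "Suc 0 mod 4 = (1 :: nat)" "Suc 1 mod 4 = (2 :: nat)" "Suc 2 mod 4 = (3 :: nat)" "Suc 3 mod 4 = (0 :: nat)"
      by simp_all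
    have reg: "lower_regular \<delta> (link 4 X F 0) (A 0) (A 1)" "lower_regular \<delta> (link 4 X F 1) (A 1) (A 2)"
      "lower_regular \<delta> (link 4 X F 2) (A 2) (A 3)" "lower_regular \<delta> (link 4 X F 3) (A 3) (A 0)"
      by (rule A(4)[of 0, unfolded m] A(4)[of 1, unfolded m] A(4)[of 2, unfolded m] A(4)[of 3, unfolded m]; simp)+
    have le: "\<delta> * card (A k) \<le> card (A k)" for k
      using \<delta> mult_right_mono[of \<delta> 1 "card (A k)"] by simp
    have fin: "finite (A 0)" "finite (A 1)" "finite (A 2)" "finite (A 3)"
      and ne: "A 0 \<noteq> {}" "A 2 \<noteq> {}" using A(1,2) by simp_all
    obtain a where a: "a \<in> A 0" "\<delta> * card (A 1) \<le> card {b \<in> A 1. (a, b) \<in> link 4 X F 0}"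
      "\<delta> * card (A 3) \<le> card {d \<in> A 3. (d, a) \<in> link 4 X F 3}"
      using ex_common_high_degree[OF reg(1,4) fin(1,2,4) ne(1) \<delta> subset_refl le subset_refl le] by blast
    define N1 where "N1 = {b \<in> A 1. (a, b) \<in> link 4 X F 0}"
    define N3 where "N3 = {d \<in> A 3. (d, a) \<in> link 4 X F 3}"
    have "N1 \<subseteq> A 1" "N3 \<subseteq> A 3" by (auto simp: N1_def N3_def)
    then obtain c where c: "c \<in> A 2" "\<delta> * card N3 \<le> card {d \<in> N3. (c, d) \<in> link 4 X F 2}"
      "\<delta> * card N1 \<le> card {b \<in> N1. (b, c) \<in> link 4 X F 1}"
      using ex_common_high_degree[OF reg(3,2) fin(3,4,2) ne(2) \<delta>, of N3 N1] a(2,3)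
      unfolding N1_def N3_def by blast
    define M1 where "M1 = {b \<in> N1. (b, c) \<in> link 4 X F 1}"
    define M3 where "M3 = {d \<in> N3. (c, d) \<in> link 4 X F 2}"
    have four: "4 \<le> \<delta> * (\<delta> * (\<tau> * q))"
    proof -
      have "4 / (\<delta>\<^sup>2 * \<tau>) < q" using q1 q by linarith
      then have "4 < q * (\<delta>\<^sup>2 * \<tau>)" using \<delta>(1) \<tau> by (simp add: divide_less_eq)
      then show ?thesis by (simp add: power2_eq_square mult_ac)
    qed
    have "4 \<le> card M1"
    proof -
      have "\<delta> * (\<tau> * q) \<le> \<delta> * card (A 1)" using A(3)[of 1] \<delta>(1) by (intro mult_left_mono) auto
      also have "\<dots> \<le> card N1" using a(2) by (simp only: N1_def)
      finally have "\<delta> * (\<delta> * (\<tau> * q)) \<le> \<delta> * card N1" using \<delta>(1) by (intro mult_left_mono) auto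
      also have "\<dots> \<le> card M1" using c(3) by (simp only: M1_def)
      finally have "4 \<le> real (card M1)" using four by linarith
      then show ?thesis by linarith
    qed
    have "4 \<le> card M3"
    proof -
      have "\<delta> * (\<tau> * q) \<le> \<delta> * card (A 3)" using A(3)[of 3] \<delta>(1) by (intro mult_left_mono) auto
      also have "\<dots> \<le> card N3" using a(3) by (simp only: N3_def)
      finally have "\<delta> * (\<delta> * (\<tau> * q)) \<le> \<delta> * card N3" using \<delta>(1) by (intro mult_left_mono) auto
      also have "\<dots> \<le> card M3" using c(2) by (simp only: M3_def)
      finally have "4 \<le> real (card M3)" using four by linarith
      then show ?thesis by linarith
    qed
    have fM: "finite M1" "finite M3" using fin by (auto simp: M1_def M3_def N1_def N3_def)
    \<comment> \<open>\<open>e\<close> is the only element that can take both values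
      \<open>a\<close> and \<open>c\<close>; if there is none, it is arbitrary. Avoiding its values
      makes \<open>x0 \<noteq> x1\<close> and \<open>x2 \<noteq> x3\<close>.\<close>
    obtain e where e: "\<And>x. x \<in> X \<Longrightarrow> F 0 x = a \<Longrightarrow> F 2 x = c \<Longrightarrow> x = e"
    proof (cases "\<exists>e\<in>X. F 0 e = a \<and> F 2 e = c")
      case True
      then obtain e where e: "e \<in> X" "F 0 e = a" "F 2 e = c" by blast
      have "x = e" if "x \<in> X" "F 0 x = a" "F 2 x = c" for x
        using agree_at_most_onceD[OF once that(1) e(1), of 0 2] that(2,3) e(2,3) by simp
      then show thesis by (rule that)
    next
      case False
      then show thesis by (intro that[of undefined]) blast
    qed
    obtain b where b: "b \<in> M1" "b \<noteq> F 1 e"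
      using ex_not_among_three[OF fM(1) \<open>4 \<le> card M1\<close>] by blast
    then have ab: "(a, b) \<in> link 4 X F 0" and bc: "(b, c) \<in> link 4 X F 1" by (auto simp: M1_def N1_def)
    obtain x0 x1 where x0: "x0 \<in> X" "F 0 x0 = a" "F 1 x0 = b" and x1: "x1 \<in> X" "F 1 x1 = b" "F 2 x1 = c"
      using linkD[OF ab, unfolded m] linkD[OF bc, unfolded m] by blast
    obtain d where d: "d \<in> M3" "d \<noteq> F 3 e" "d \<noteq> F 3 x0" "d \<noteq> F 3 x1"
      using ex_not_among_three[OF fM(2) \<open>4 \<le> card M3\<close>] by blast
    then have cd: "(c, d) \<in> link 4 X F 2" and da: "(d, a) \<in> link 4 X F 3" by (auto simp: M3_def N3_def)
    obtain x2 x3 where x2: "x2 \<in> X" "F 2 x2 = c" "F 3 x2 = d" and x3: "x3 \<in> X" "F 3 x3 = d" "F 0 x3 = a"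
      using linkD[OF cd, unfolded m] linkD[OF da, unfolded m] by blast
    have "x0 \<noteq> x1" using e[of x0] x0 x1 b(2) by auto
    moreover have "x2 \<noteq> x3" using e[of x2] x2 x3 d(2) by auto
    moreover have "x0 \<noteq> x2" "x0 \<noteq> x3" "x1 \<noteq> x2" "x1 \<noteq> x3" using x2 x3 d by auto
    ultimately have dist: "x0 \<noteq> x1" "x0 \<noteq> x2" "x0 \<noteq> x3" "x1 \<noteq> x2" "x1 \<noteq> x3" "x2 \<noteq> x3" by blast+
    \<comment> \<open>Starts with \<open>x3\<close>, so that the \<open>i\<close>-th element and the
      next one share their value under \<open>F i\<close>.\<close>
    define v where "v i = (if i = 0 then x3 else if i = 1 then x0 else if i = 2 then x1 else x2)" for i :: nat
    have v: "v 0 = x3" "v 1 = x0" "v 2 = x1" "v 3 = x2" by (simp_all add: v_def)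
    have "{..<4} = {0, 1, 2, 3 :: nat}" by auto
    then have "inj_on v {..<4}" "v ` {..<4} \<subseteq> X"
      using v x0(1) x1(1) x2(1) x3(1) dist by auto
    moreover have "F i (v i) = F i (v (Suc i mod 4))" if i: "i < 4" for i
    proof -
      have eqs: "F 0 (v 0) = F 0 (v 1)" "F 1 (v 1) = F 1 (v 2)" "F 2 (v 2) = F 2 (v 3)" "F 3 (v 3) = F 3 (v 0)"
        by (simp_all only: v x0 x1 x2 x3)
      consider "i = 0" | "i = 1" | "i = 2" | "i = 3" using i by linarith
      then show ?thesis
      proof cases
        case 1
        show ?thesis unfolding 1 m by (rule eqs)
      next
        case 2
        show ?thesis unfolding 2 m by (rule eqs)
      next
        case 3
        show ?thesis unfolding 3 m by (rule eqs)
      next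
        case 4
        show ?thesis unfolding 4 m by (rule eqs)
      qed
    qed
    ultimately show ?thesis unfolding cycle_seed_def by blast
  qed
  show ?thesis by (intro exI[of _ "Suc q1"] allI impI) (rule main)
qed

section \<open>Extending cycles to unseparated sets\<close>

text \<open>Take \<open>Z\<close> maximising \<open>card Z - u * (number of pairs (k, y) with y \<in> F k ` Z)\<close>: removing a fibre
  with fewer than \<open>u\<close> elements would increase this quantity.\<close>

lemma ex_subset_large_fibres:
  fixes F :: "nat \<Rightarrow> 'a \<Rightarrow> nat"
  assumes X: "finite X" and F: "\<forall>k<u. \<forall>x\<in>X. F k x < q"
  shows "\<exists>Z\<subseteq>X. (\<forall>z\<in>Z. \<forall>k<u. u \<le> card {y \<in> Z. F k y = F k z}) \<and> card X \<le> card Z + u * u * q"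
proof -
  define P where "P Z = (\<lambda>(k, x). (k, F k x)) ` ({..<u} \<times> Z)" for Z
  define pot where "pot Z = int (card Z) - int u * int (card (P Z))" for Z
  have fin: "finite (pot ` Pow X)" using X by simp
  have "Max (pot ` Pow X) \<in> pot ` Pow X" using fin by (intro Max_in) auto
  then obtain Z where Z: "Z \<subseteq> X" "pot Z = Max (pot ` Pow X)" by auto
  have max: "pot Z' \<le> pot Z" if "Z' \<subseteq> X" for Z'
    unfolding Z(2) using fin that by (intro Max_ge) auto
  have fZ: "finite Z" using Z(1) X by (rule finite_subset)
  then have fP: "finite (P Z)" by (simp add: P_def)
  have "u \<le> card {y \<in> Z. F k y = F k z}" if z: "z \<in> Z" "k < u" for z k
  proof (rule ccontr)
    let ?f = "{y \<in> Z. F k y = F k z}"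
    assume "\<not> u \<le> card ?f"
    have "P (Z - ?f) \<subseteq> P Z - {(k, F k z)}" by (auto simp: P_def)
    then have "card (P (Z - ?f)) \<le> card (P Z - {(k, F k z)})" using fP by (intro card_mono) auto
    moreover have "(k, F k z) \<in> P Z" using z by (force simp: P_def)
    then have "Suc (card (P Z - {(k, F k z)})) = card (P Z)" using fP by (rule card_Suc_Diff1[rotated])
    ultimately have "int (card (P (Z - ?f))) + 1 \<le> int (card (P Z))" by linarith
    then have "int u * (int (card (P (Z - ?f))) + 1) \<le> int u * int (card (P Z))"
      by (rule mult_left_mono) simp
    moreover have "int u * (int (card (P (Z - ?f))) + 1) = int u * int (card (P (Z - ?f))) + int u"
      by (simp only: distrib_left mult_1_right)
    moreover have "card (Z - ?f) = card Z - card ?f" by (rule card_Diff_subset) (use fZ in auto)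
    moreover have "card ?f \<le> card Z" by (rule card_mono[OF fZ]) auto
    ultimately have "pot Z < pot (Z - ?f)"
      using \<open>\<not> u \<le> card ?f\<close> unfolding pot_def by linarith
    moreover have "pot (Z - ?f) \<le> pot Z" by (rule max) (use Z(1) in blast)
    ultimately show False by simp
  qed
  moreover have "card X \<le> card Z + u * u * q"
  proof -
    \<comment> \<open>Comparison with \<open>X\<close> itself, which has at most
      \<open>u * q\<close> pairs, each of weight \<open>u\<close>.\<close>
    have "P X \<subseteq> {..<u} \<times> {..<q}" using F by (auto simp: P_def)
    then have "card (P X) \<le> card ({..<u} \<times> {..<q})" by (intro card_mono) auto
    then have "int u * int (card (P X)) \<le> int u * (int u * int q)"
      by (intro mult_left_mono) (simp_all add: card_cartesian_product flip: of_nat_mult)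
    moreover have "pot X \<le> pot Z" by (rule max) simp
    moreover have "0 \<le> int u * int (card (P Z))" by simp
    ultimately have "int (card X) \<le> int (card Z) + int u * (int u * int q)"
      unfolding pot_def by linarith
    then have "int (card X) \<le> int (card Z + u * u * q)" by (simp add: mult.assoc)
    then show ?thesis by (simp only: of_nat_le_iff)
  qed
  ultimately show ?thesis using Z(1) by blast
qed

lemma extend_collisions:
  fixes F :: "nat \<Rightarrow> 'a \<Rightarrow> 'b" and cl :: "'s \<Rightarrow> 'c"
  assumes Z: "finite Z" "\<forall>z\<in>Z. \<forall>k<u. u \<le> card {y \<in> Z. F k y = F k z}"
    and U: "finite U" "card U = u"
    and S: "S \<subseteq> U" "inj_on \<phi> S" "\<phi> ` S \<subseteq> Z" "\<exists>a\<in>S. \<exists>b\<in>S. cl a \<noteq> cl b"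
    and J: "J \<subseteq> {..<u}" "card J = card S"
      "\<forall>k\<in>J. \<exists>a\<in>S. \<exists>b\<in>S. cl a \<noteq> cl b \<and> F k (\<phi> a) = F k (\<phi> b)"
  shows "\<exists>\<phi>. inj_on \<phi> U \<and> \<phi> ` U \<subseteq> Z \<and> (\<forall>k<u. \<exists>a\<in>U. \<exists>b\<in>U. cl a \<noteq> cl b \<and> F k (\<phi> a) = F k (\<phi> b))"
  using S J
proof (induction "card (U - S)" arbitrary: S J \<phi>)
  case 0
  then have "S = U" using U(1) by (simp add: card_eq_0_iff)
  then have "J = {..<u}" using 0 U(2) by (intro card_subset_eq) auto
  then show ?case using 0 \<open>S = U\<close> by blast
next
  case (Suc n)
  have fS: "finite S" using Suc.prems(1) U(1) by (rule finite_subset)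
  obtain b where b: "b \<in> U" "b \<notin> S" using Suc.hyps(2) by (metis Diff_eq_empty_iff card.empty nat.distinct(1) subsetI)
  \<comment> \<open>Two classes occur in \<open>S\<close>, so one of them differs from that of
    \<open>b\<close>.\<close>
  obtain a where a: "a \<in> S" "cl a \<noteq> cl b" using Suc.prems(4) by metis
  have lt: "card S < u" using b Suc.prems(1) U psubset_card_mono[of U S] by blast
  then obtain k where k: "k < u" "k \<notin> J"
    using Suc.prems(5,6) by (metis card_lessThan less_irrefl lessThan_iff subsetI subset_antisym)
  have "\<phi> a \<in> Z" using Suc.prems(3) a(1) by blast
  then have "card (\<phi> ` S) < card {y \<in> Z. F k y = F k (\<phi> a)}"
    using Z(2) k(1) lt card_image_le[OF fS, of \<phi>] by (meson le_less_trans less_le_trans)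
  then have "\<not> {y \<in> Z. F k y = F k (\<phi> a)} \<subseteq> \<phi> ` S"
    using card_mono[of "\<phi> ` S"] fS by (meson finite_imageI not_le)
  then obtain z where z: "z \<in> Z" "F k z = F k (\<phi> a)" "z \<notin> \<phi> ` S" by blast
  define \<psi> where "\<psi> = \<phi>(b := z)"
  have \<psi>: "\<psi> x = \<phi> x" if "x \<in> S" for x using that b(2) by (auto simp: \<psi>_def)
  have \<psi>b: "\<psi> b = z" by (simp add: \<psi>_def)
  show ?case
  proof (rule Suc.hyps(1)[of "insert b S" \<psi> "insert k J"])
    have "U - insert b S = (U - S) - {b}" by blast
    then show "n = card (U - insert b S)" using Suc.hyps(2) b U(1) by simp
    have im: "\<psi> ` S = \<phi> ` S" by (rule image_cong) (simp_all add: \<psi>)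
    have "inj_on \<psi> S = inj_on \<phi> S" by (rule inj_on_cong) (rule \<psi>)
    then show "inj_on \<psi> (insert b S)"
      using Suc.prems(2) z(3) b(2) im \<psi>b by simp
    show "\<psi> ` insert b S \<subseteq> Z" using Suc.prems(3) z(1) im \<psi>b by simp
    show "\<exists>a\<in>insert b S. \<exists>b\<in>insert b S. cl a \<noteq> cl b" using a by blast
    show "card (insert k J) = card (insert b S)"
      using Suc.prems(5,6) k(2) b(2) fS finite_subset[of J "{..<u}"] by simp
    show "\<forall>k\<in>insert k J. \<exists>a\<in>insert b S. \<exists>b\<in>insert b S. cl a \<noteq> cl b \<and> F k (\<psi> a) = F k (\<psi> b)"
    proof
      fix k' assume "k' \<in> insert k J"
      then consider "k' = k" | "k' \<in> J" by blast
      then show "\<exists>a\<in>insert b S. \<exists>b\<in>insert b S. cl a \<noteq> cl b \<and> F k' (\<psi> a) = F k' (\<psi> b)"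
      proof cases
        case 1
        then have "F k' (\<psi> a) = F k' (\<psi> b)" using z(2) \<psi>[OF a(1)] \<psi>b by simp
        then show ?thesis using a by blast
      next
        case 2
        then obtain a' b' where "a' \<in> S" "b' \<in> S" "cl a' \<noteq> cl b'" "F k' (\<phi> a') = F k' (\<phi> b')"
          using Suc.prems(7) by blast
        then show ?thesis using \<psi> by (metis insertI2)
      qed
    qed
  qed (use Suc.prems(1,5) b(1) k(1) in auto)
qed

section \<open>Cycles placed in the sets to be separated\<close>

definition slots :: "nat \<Rightarrow> (nat \<Rightarrow> nat) \<Rightarrow> (nat \<times> nat) set" where
  "slots t w = (SIGMA i:{1..t}. {..<w i})"

text \<open>The elements placed in the slots with first component \<open>i\<close> form the set
  \<open>C i\<close>; a collision between slots with different first components prevents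
  separation.\<close>

lemma not_separating_if_collisions:
  fixes \<phi> :: "nat \<times> nat \<Rightarrow> 'a"
  assumes \<phi>: "inj_on \<phi> (slots t w)" "\<phi> ` slots t w \<subseteq> X"
    and coll: "\<forall>k<u. \<exists>a\<in>slots t w. \<exists>b\<in>slots t w. fst a \<noteq> fst b \<and> F k (\<phi> a) = F k (\<phi> b)"
  shows "\<not> separating_hash_family u X Y (image_mset w (mset_set {1..t})) F"
proof
  define C where "C i = \<phi> ` ({i} \<times> {..<w i})" for i
  define Cs where "Cs = map C [1..<Suc t]"
  assume sep: "separating_hash_family u X Y (image_mset w (mset_set {1..t})) F"
  have len: "length Cs = t" by (simp add: Cs_def)
  have nth: "Cs ! i = C (Suc i)" if "i < t" for i
    using that by (simp add: Cs_def nth_append del: upt_Suc)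
  have sub: "{i} \<times> {..<w i} \<subseteq> slots t w" if "i \<in> {1..t}" for i
    using that by (auto simp: slots_def)
  have "\<forall>D\<in>set Cs. D \<subseteq> X" using \<phi>(2) sub by (fastforce simp: Cs_def C_def)
  moreover have "mset (map card Cs) = image_mset w (mset_set {1..t})"
  proof -
    have "card (C i) = w i" if "i \<in> {1..t}" for i
      using card_image[OF inj_on_subset[OF \<phi>(1) sub[OF that]]] by (simp add: C_def card_cartesian_product)
    then have "map card Cs = map w [1..<Suc t]" by (auto simp: Cs_def simp del: upt_Suc)
    also have "mset \<dots> = image_mset w (mset_set {1..<Suc t})" by (simp only: mset_map mset_upt)
    also have "{1..<Suc t} = {1..t}" by auto
    finally show ?thesis .
  qed
  moreover have "pairwise_disjoint_list Cs"
    unfolding pairwise_disjoint_list_def disjoint_family_on_def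
  proof (intro ballI impI)
    fix i j assume ij: "i \<in> {..<length Cs}" "j \<in> {..<length Cs}" "i \<noteq> j"
    have "C (Suc i) \<inter> C (Suc j) = \<phi> ` (({Suc i} \<times> {..<w (Suc i)}) \<inter> ({Suc j} \<times> {..<w (Suc j)}))"
      unfolding C_def using ij len by (intro inj_on_image_Int[OF \<phi>(1), symmetric] sub) auto
    also have "\<dots> = {}" using ij(3) by auto
    finally show "Cs ! i \<inter> Cs ! j = {}" using ij len by (simp add: nth)
  qed
  ultimately obtain k where k: "k < u" "separates (F k) Cs"
    using sep unfolding separating_hash_family_def by blast
  obtain a b where ab: "a \<in> slots t w" "b \<in> slots t w" "fst a \<noteq> fst b" "F k (\<phi> a) = F k (\<phi> b)"
    using coll k(1) by blast
  have mem: "\<phi> x \<in> Cs ! (fst x - 1) \<and> fst x - 1 < length Cs \<and> 1 \<le> fst x" if "x \<in> slots t w" for x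
  proof -
    have "1 \<le> fst x" "fst x \<le> t" "snd x < w (fst x)" using that by (auto simp: slots_def)
    then have "\<phi> x \<in> C (fst x)" unfolding C_def by (intro imageI) (simp add: mem_Times_iff)
    with \<open>1 \<le> fst x\<close> \<open>fst x \<le> t\<close> show ?thesis by (simp add: nth len)
  qed
  have "map ((`) (F k)) Cs ! (fst a - 1) \<inter> map ((`) (F k)) Cs ! (fst b - 1) = {}"
    using k(2)[unfolded separates_def pairwise_disjoint_list_def] mem[OF ab(1)] mem[OF ab(2)] ab(3)
    by (intro disjoint_family_onD) auto
  moreover have ab_mem: "fst a - 1 < length Cs" "\<phi> a \<in> Cs ! (fst a - 1)"
      "fst b - 1 < length Cs" "\<phi> b \<in> Cs ! (fst b - 1)"
    using mem[OF ab(1)] mem[OF ab(2)] by blast+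
  have "F k (\<phi> a) \<in> map ((`) (F k)) Cs ! (fst a - 1)"
    unfolding nth_map[OF ab_mem(1)] using ab_mem(2) by (rule imageI)
  moreover have "F k (\<phi> a) \<in> map ((`) (F k)) Cs ! (fst b - 1)"
    unfolding nth_map[OF ab_mem(3)] ab(4) using ab_mem(4) by (rule imageI)
  ultimately show False by blast
qed

text \<open>A cycle occupies as many slots as it has colours, which is the balance required to start
  \<open>extend_collisions\<close>; consecutive slots lie in different sets, so each of its colours
  is spoiled.\<close>

lemma not_separating_if_rainbow_cycle:
  fixes F :: "nat \<Rightarrow> 'a \<Rightarrow> 'b"
  assumes Z: "finite Z" "Z \<subseteq> X" "\<forall>z\<in>Z. \<forall>k<u. u \<le> card {y \<in> Z. F k y = F k z}"
    and u: "u = (\<Sum>i=1..t. w i)"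
    and cyc: "rainbow_cycle u Z F l v \<kappa>"
    and s: "inj_on s {..<l}" "s ` {..<l} \<subseteq> slots t w" "\<forall>i<l. fst (s i) \<noteq> fst (s (Suc i mod l))"
  shows "\<not> separating_hash_family u X Y (image_mset w (mset_set {1..t})) F"
proof -
  have c: "2 \<le> l" "inj_on v {..<l}" "v ` {..<l} \<subseteq> Z" "inj_on \<kappa> {..<l}" "\<kappa> ` {..<l} \<subseteq> {..<u}"
    "\<And>i. i < l \<Longrightarrow> F (\<kappa> i) (v i) = F (\<kappa> i) (v (Suc i mod l))"
    using cyc unfolding rainbow_cycle_def by auto
  define \<phi> where "\<phi> a = v (inv_into {..<l} s a)" for a
  have \<phi>s: "\<phi> (s i) = v i" if "i < l" for i using s(1) that by (simp add: \<phi>_def)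
  have sk: "Suc i mod l < l" for i using c(1) by simp
  have U: "finite (slots t w)" "card (slots t w) = u" using u by (simp_all add: slots_def)
  have "\<exists>\<phi>. inj_on \<phi> (slots t w) \<and> \<phi> ` slots t w \<subseteq> Z \<and>
      (\<forall>k<u. \<exists>a\<in>slots t w. \<exists>b\<in>slots t w. fst a \<noteq> fst b \<and> F k (\<phi> a) = F k (\<phi> b))"
  proof (rule extend_collisions[where F = F and cl = fst and Z = Z and u = u and U = "slots t w"
        and S = "s ` {..<l}" and \<phi> = \<phi> and J = "\<kappa> ` {..<l}"])
    have "inj_on (\<phi> \<circ> s) {..<l} = inj_on v {..<l}" by (rule inj_on_cong) (simp add: \<phi>s)
    then show "inj_on \<phi> (s ` {..<l})" using c(2) by (intro inj_on_imageI) simp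
    have "\<phi> ` s ` {..<l} = v ` {..<l}" unfolding image_image by (rule image_cong) (simp_all add: \<phi>s)
    then show "\<phi> ` s ` {..<l} \<subseteq> Z" using c(3) by simp
    show "card (\<kappa> ` {..<l}) = card (s ` {..<l})" using c(4) s(1) by (simp add: card_image)
    show "\<exists>a\<in>s ` {..<l}. \<exists>b\<in>s ` {..<l}. fst a \<noteq> fst b"
    proof (intro bexI)
      show "fst (s 0) \<noteq> fst (s (Suc 0 mod l))" using s(3)[rule_format, of 0] c(1) by simp
    qed (use sk[of 0] c(1) in \<open>auto intro: imageI\<close>)
    show "\<forall>k\<in>\<kappa> ` {..<l}. \<exists>a\<in>s ` {..<l}. \<exists>b\<in>s ` {..<l}. fst a \<noteq> fst b \<and> F k (\<phi> a) = F k (\<phi> b)"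
    proof
      fix k assume "k \<in> \<kappa> ` {..<l}"
      then obtain i where i: "i < l" "k = \<kappa> i" by auto
      have "F k (\<phi> (s i)) = F k (\<phi> (s (Suc i mod l)))" using c(6)[OF i(1)] \<phi>s[OF i(1)] \<phi>s[OF sk] i(2) by simp
      then show "\<exists>a\<in>s ` {..<l}. \<exists>b\<in>s ` {..<l}. fst a \<noteq> fst b \<and> F k (\<phi> a) = F k (\<phi> b)"
        using s(3) i(1) sk by blast
    qed
  qed (rule Z U s(2) c(5))+
  then obtain \<phi> where "inj_on \<phi> (slots t w)" "\<phi> ` slots t w \<subseteq> Z"
      "\<forall>k<u. \<exists>a\<in>slots t w. \<exists>b\<in>slots t w. fst a \<noteq> fst b \<and> F k (\<phi> a) = F k (\<phi> b)" by blast
  then show ?thesis using Z(2) by (intro not_separating_if_collisions) auto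
qed

text \<open>After restriction to large fibres, two elements that agree twice give a cycle of length
  2; otherwise the remaining set is dense enough for a cycle of length 3 or 4. Either extends to
  unseparated sets.\<close>

lemma separating_small:
  fixes w :: "nat \<Rightarrow> nat" and \<epsilon> :: real
  assumes t: "2 \<le> t" and w: "\<forall>i\<in>{1..t}. 1 \<le> w i" and excl: "t \<noteq> 2 \<or> min (w 1) (w 2) \<noteq> 1"
    and u: "u = (\<Sum>i=1..t. w i)" and \<epsilon>: "0 < \<epsilon>"
  shows "\<exists>q0. \<forall>q\<ge>q0. \<forall>n (F :: nat \<Rightarrow> nat \<Rightarrow> nat).
     separating_hash_family u {..<n} {..<q} (image_mset w (mset_set {1..t})) F \<longrightarrow> n \<le> \<epsilon> * (real q)\<^sup>2"
proof -
  \<comment> \<open>With two classes a cycle must alternate between them; length 4 takes two slots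
    of each, which the exclusion of \<open>min (w 1) (w 2) = 1\<close> provides. With at least three
    classes a triangle takes one slot from each of three.\<close>
  define l :: nat where "l = (if t = 2 then 4 else 3)"
  define s :: "nat \<Rightarrow> nat \<times> nat" where
    "s i = (if t = 2 then (Suc (i mod 2), i div 2) else (Suc i, 0))" for i
  have s: "inj_on s {..<l}" "s ` {..<l} \<subseteq> slots t w" "\<forall>i<l. fst (s i) \<noteq> fst (s (Suc i mod l))"
    and lu: "l \<le> u"
  proof -
    have "inj_on s {..<l} \<and> s ` {..<l} \<subseteq> slots t w \<and> (\<forall>i<l. fst (s i) \<noteq> fst (s (Suc i mod l))) \<and> l \<le> u"
    proof (cases "t = 2")
      case True
      have "1 \<in> {1..t}" "2 \<in> {1..t}" using True by simp_all
      then have "1 \<le> w 1" "1 \<le> w 2" using w by blast+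
      then have "2 \<le> min (w 1) (w 2)" using excl True by (simp add: min_def split: if_splits)
      then have w2: "2 \<le> w 1" "2 \<le> w 2" by simp_all
      have 4: "{..<4} = {0, 1, 2, 3 :: nat}" by auto
      have "{1..2} = {1, 2 :: nat}" by auto
      then have "u = w 1 + w 2" using u True by simp
      moreover have s0: "s 0 = (1, 0)" "s 1 = (2, 0)" "s 2 = (1, 1)" "s 3 = (2, 1)"
        using True by (simp_all add: s_def)
      moreover have "\<forall>i\<in>{..<4}. fst (s i) \<noteq> fst (s (Suc i mod 4))"
        unfolding 4 using True by (simp add: s_def)
      moreover have "inj_on s {..<4}" unfolding 4 using s0 by simp
      moreover have "s ` {..<4} \<subseteq> slots t w" unfolding 4 using s0 True w2 by (simp add: slots_def)
      ultimately show ?thesis using True w2 by (simp add: l_def)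
    next
      case False
      have "t = (\<Sum>i=1..t. 1)" by simp
      also have "\<dots> \<le> u" unfolding u using w by (intro sum_mono) auto
      finally have "3 \<le> u" using t False by simp
      moreover have "fst (s i) \<noteq> fst (s (Suc i mod 3))" if "i < 3" for i
        using Suc_mod_neq[of 3 i] that False by (simp add: s_def)
      moreover have "s ` {..<3} \<subseteq> slots t w"
      proof
        fix x assume "x \<in> s ` {..<3}"
        then obtain i where i: "i < 3" "x = (Suc i, 0)" using False by (auto simp: s_def)
        then have "Suc i \<in> {1..t}" using t False by auto
        with w have "1 \<le> w (Suc i)" by blast
        with \<open>Suc i \<in> {1..t}\<close> i(2) show "x \<in> slots t w" by (simp add: slots_def)
      qed
      moreover have "inj_on s {..<3}" using False by (simp add: s_def inj_on_def)
      ultimately show ?thesis using False by (simp add: l_def)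
    qed
    then show "inj_on s {..<l}" "s ` {..<l} \<subseteq> slots t w" "\<forall>i<l. fst (s i) \<noteq> fst (s (Suc i mod l))" "l \<le> u"
      by blast+
  qed
  have "\<exists>q0. \<forall>q\<ge>q0. \<forall>(X :: nat set) (F :: nat \<Rightarrow> nat \<Rightarrow> nat). finite X \<longrightarrow> (\<forall>k<l. \<forall>x\<in>X. F k x < q) \<longrightarrow>
    agree_at_most_once l X F \<longrightarrow> \<epsilon> / 2 * (real q)\<^sup>2 \<le> card X \<longrightarrow> cycle_seed l X F"
  proof (cases "t = 2")
    case True
    then have "l = 4" by (simp add: l_def)
    then show ?thesis using ex_four_cycle[of "\<epsilon> / 2", where 'a = nat] \<epsilon> by simp
  next
    case False
    then have "l = 3" by (simp add: l_def)
    then show ?thesis using ex_triangle[of "\<epsilon> / 2", where 'a = nat] \<epsilon> by simp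
  qed
  then obtain q0 where q0: "\<forall>q\<ge>q0. \<forall>(X :: nat set) (F :: nat \<Rightarrow> nat \<Rightarrow> nat). finite X \<longrightarrow>
    (\<forall>k<l. \<forall>x\<in>X. F k x < q) \<longrightarrow> agree_at_most_once l X F \<longrightarrow> \<epsilon> / 2 * (real q)\<^sup>2 \<le> card X \<longrightarrow> cycle_seed l X F" ..
  \<comment> \<open>For \<open>q \<ge> q1\<close> the at most \<open>u * u * q\<close> elements lost
    with the small fibres number at most \<open>\<epsilon> / 2 * q\<^sup>2\<close>.\<close>
  obtain q1 :: nat where q1: "2 * real (u * u) / \<epsilon> < q1" using reals_Archimedean2 by blast
  have main: "n \<le> \<epsilon> * (real q)\<^sup>2"
    if q: "max q0 q1 \<le> q"
      and sep: "separating_hash_family u {..<n} {..<q} (image_mset w (mset_set {1..t})) F"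
    for q n and F :: "nat \<Rightarrow> nat \<Rightarrow> nat"
  proof (rule ccontr)
    assume "\<not> ?thesis"
    then have n: "\<epsilon> * (real q)\<^sup>2 < n" by simp
    have F: "\<forall>k<u. \<forall>x\<in>{..<n}. F k x < q"
      using sep unfolding separating_hash_family_def hash_family_def by blast
    obtain Z where Z: "Z \<subseteq> {..<n}" "\<forall>z\<in>Z. \<forall>k<u. u \<le> card {y \<in> Z. F k y = F k z}"
      "card {..<n} \<le> card Z + u * u * q"
      using ex_subset_large_fibres[OF finite_lessThan F] by blast
    have fZ: "finite Z" using Z(1) finite_subset by blast
    note no = not_separating_if_rainbow_cycle[OF fZ Z(1,2) u]
    have ZF: "\<forall>k<l. \<forall>x\<in>Z. F k x < q" using F Z(1) lu by auto
    have large: "\<epsilon> / 2 * (real q)\<^sup>2 \<le> card Z"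
    proof -
      have "2 * real (u * u) / \<epsilon> < q" using q1 q by linarith
      then have "2 * real (u * u) \<le> q * \<epsilon>" using \<epsilon> by (simp add: divide_less_eq)
      then have "2 * real (u * u) * q \<le> q * \<epsilon> * q" by (rule mult_right_mono) simp
      then have "real (u * u * q) \<le> \<epsilon> / 2 * (real q)\<^sup>2" by (simp add: power2_eq_square mult_ac)
      moreover have "real n \<le> real (card Z + u * u * q)" using Z(3) by (intro of_nat_mono) simp
      ultimately show ?thesis using n unfolding of_nat_add by linarith
    qed
    show False
    proof (cases "agree_at_most_once u Z F")
      case True
      then have once: "agree_at_most_once l Z F"
        using lu unfolding agree_at_most_once_def by (meson less_le_trans)
      have "cycle_seed l Z F"
        by (rule q0[rule_format, OF _ fZ _ once large]) (use q ZF in auto)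
      then obtain v where "inj_on v {..<l}" "v ` {..<l} \<subseteq> Z" "\<forall>i<l. F i (v i) = F i (v (Suc i mod l))"
        unfolding cycle_seed_def by blast
      then have "rainbow_cycle u Z F l v (\<lambda>i. i)"
        unfolding rainbow_cycle_def using lu by (auto simp: l_def)
      then show False using no[OF _ s] sep by blast
    next
      case False
      then obtain x y k k' where xy: "x \<in> Z" "y \<in> Z" "k < u" "k' < u" "k \<noteq> k'" "F k x = F k y" "F k' x = F k' y" "x \<noteq> y"
        unfolding agree_at_most_once_def by blast
      have 2: "{..<2} = {0, 1 :: nat}" by auto
      define v where "v i = (if i = 0 then x else y)" for i :: nat
      define \<kappa> where "\<kappa> i = (if i = 0 then k else k')" for i :: nat
      have "\<forall>i\<in>{..<2}. F (\<kappa> i) (v i) = F (\<kappa> i) (v (Suc i mod 2))"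
        unfolding 2 using xy by (simp add: v_def \<kappa>_def)
      then have "rainbow_cycle u Z F 2 v \<kappa>"
        unfolding rainbow_cycle_def using xy by (auto simp: 2 v_def \<kappa>_def)
      moreover have "inj_on (\<lambda>i. (Suc i, 0 :: nat)) {..<2}" by (auto simp: inj_on_def)
      moreover have "(\<lambda>i. (Suc i, 0 :: nat)) ` {..<2} \<subseteq> slots t w"
        using t w by (auto simp: 2 slots_def Suc_le_eq)
      moreover have "\<forall>i<2. fst (Suc i, 0 :: nat) \<noteq> fst (Suc (Suc i mod 2), 0 :: nat)"
        using Suc_mod_neq[of 2] by auto
      ultimately show False using no sep by blast
    qed
  qed
  show ?thesis by (intro exI[of _ "max q0 q1"] allI impI) (rule main)
qed

section \<open>Asymptotics\<close>

lemma eventually_linear_dominates_log: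
  fixes A B C S :: real
  assumes "B < A" "0 < C" "0 \<le> S"
  shows "\<forall>\<^sub>F m :: nat in sequentially. B * (real m + 1) + S * ln (1 + C * real m) < A * real m"
proof -
  have "(\<lambda>m :: nat. (B * (real m + 1) + S * ln (1 + C * real m)) / real m) \<longlonglongrightarrow> B"
    using \<open>0 < C\<close> by real_asymp
  then have "\<forall>\<^sub>F m :: nat in sequentially. (B * (real m + 1) + S * ln (1 + C * real m)) / real m < A"
    using assms(1) by (rule order_tendstoD)
  then show ?thesis
    using eventually_gt_at_top[of "0 :: nat"]
    by eventually_elim (simp add: divide_less_eq mult.commute)
qed

text \<open>For large \<open>L\<close> the vectors \<open>r\<close> have almost as many coefficients
  as the vectors \<open>p\<close>, which brings the exponent of the construction close to 2.\<close>

lemma ex_dimension: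
  fixes \<delta> :: real
  assumes "0 < \<delta>"
  shows "\<exists>L\<ge>1. (1 - \<delta>) * real (Suc L ^ u) < real (L ^ u)"
proof -
  have "(\<lambda>L. real L / real (Suc L)) \<longlonglongrightarrow> 1" by real_asymp
  then have "(\<lambda>L. (real L / real (Suc L)) ^ u) \<longlonglongrightarrow> 1 ^ u" by (rule tendsto_power)
  then have "(\<lambda>L. (real L / real (Suc L)) ^ u) \<longlonglongrightarrow> 1" by simp
  then have "\<forall>\<^sub>F L in sequentially. 1 - \<delta> < (real L / real (Suc L)) ^ u"
    using assms by (intro order_tendstoD(1)[of _ 1]) simp_all
  then have "\<forall>\<^sub>F L in sequentially. 1 - \<delta> < (real L / real (Suc L)) ^ u \<and> 1 \<le> L"
    using eventually_ge_at_top[of "1 :: nat"] by eventually_elim blast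
  then obtain L where L: "1 - \<delta> < (real L / real (Suc L)) ^ u" "1 \<le> L"
    unfolding eventually_sequentially by blast
  have "0 < real (Suc L) ^ u" by simp
  with L(1) have "(1 - \<delta>) * real (Suc L) ^ u < real L ^ u"
    by (simp add: power_divide pos_less_divide_eq del: of_nat_Suc)
  with L(2) show ?thesis by (intro exI[of _ L]) (simp add: of_nat_power del: of_nat_Suc power_Suc)
qed

text \<open>First \<open>L\<close> and then \<open>d\<close> are fixed, and only \<open>m\<close>
  grows with \<open>q\<close>. For \<open>q\<close> between consecutive powers of
  \<open>D = (2 * d) ^ b\<close> the logarithm of the number of pairs is linear in \<open>m\<close>,
  while the pigeonhole loss contributes only a term logarithmic in \<open>m\<close>.\<close>

lemma SHF_lower_bound:
  fixes \<delta> :: real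
  assumes u: "1 \<le> u" and \<delta>: "0 < \<delta>" "\<delta> \<le> 1" and W: "sum_mset W \<le> u"
  shows "\<forall>\<^sub>F q in sequentially. \<exists>n\<in>SHF_sizes u q W. real q powr (2 - \<delta>) < n"
proof -
  obtain L where L: "1 \<le> L" "(1 - \<delta> / 4) * real (Suc L ^ u) < real (L ^ u)"
    using ex_dimension[of "\<delta> / 4" u] \<delta> by auto
  define a b where "a = L ^ u" and "b = Suc L ^ u"
  have ab: "(1 - \<delta> / 4) * real b < real a" using L(2) by (simp only: a_def b_def)
  have b: "1 \<le> b" by (simp add: b_def del: power_Suc)
  \<comment> \<open>\<open>ln d > 8 / (3 * \<delta>)\<close> makes
    \<open>(2 - \<delta>) * (1 + ln d) < (2 - \<delta> / 4) * ln d\<close>, which absorbs the growth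
    of the coefficient bound from \<open>d\<close> to \<open>2 * d\<close>.\<close>
  obtain d0 :: nat where d0: "exp (8 / (3 * \<delta>)) < d0" using reals_Archimedean2 by blast
  define d where "d = d0 + 2"
  have d: "2 \<le> d" by (simp add: d_def)
  have "exp (8 / (3 * \<delta>)) < real d" using d0 by (simp add: d_def)
  then have "exp (8 / (3 * \<delta>)) < exp (ln (real d))" using d by (subst exp_ln) auto
  then have "8 / (3 * \<delta>) < ln (real d)" by (simp only: exp_less_cancel_iff)
  then have lnd: "8 < 3 * \<delta> * ln (real d)" using \<delta> by (simp add: divide_less_eq mult_ac)
  \<comment> \<open>\<open>A * m\<close> is the logarithm of the number of pairs before the
    pigeonhole step, and \<open>B * (m + 1)\<close> bounds \<open>(2 - \<delta>) * ln q\<close> from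
    above.\<close>
  define A B where "A = real (a + b) * ln (real d)" and "B = real b * (2 - \<delta>) * ln (real (2 * d))"
  have BA: "B < A"
  proof -
    have "ln (real (2 * d)) = ln 2 + ln (real d)" using d by (simp add: ln_mult)
    moreover have "ln (2 :: real) \<le> 1" using ln_le_minus_one[of 2] by simp
    ultimately have "(2 - \<delta>) * ln (real (2 * d)) \<le> (2 - \<delta>) * (1 + ln (real d))"
      using \<delta> by (intro mult_left_mono) auto
    also have "\<dots> < (2 - \<delta> / 4) * ln (real d)" using lnd \<delta> by (simp add: algebra_simps)
    finally have "real b * ((2 - \<delta>) * ln (real (2 * d))) < real b * ((2 - \<delta> / 4) * ln (real d))"
      using b by (intro mult_strict_left_mono) auto
    also have "\<dots> = ((1 - \<delta> / 4) * real b + real b) * ln (real d)" by (simp add: algebra_simps)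
    also have "\<dots> \<le> (real a + real b) * ln (real d)" using ab d by (intro mult_right_mono) auto
    finally show ?thesis by (simp add: A_def B_def mult.assoc)
  qed
  obtain C where C: "\<And>m q W. (2 * d) ^ (m * b) \<le> q \<Longrightarrow> sum_mset W \<le> u \<Longrightarrow>
      \<exists>n\<in>SHF_sizes u q W. d ^ (m * (a + b)) \<le> n * Suc (m * C) ^ ((2 * u) ^ u)"
    using SHF_sizes_poly_hash[OF d L(1) u] unfolding a_def b_def by blast
  define S where "S = real ((2 * u) ^ u)"
  have "\<forall>\<^sub>F m :: nat in sequentially. B * (real m + 1) + S * ln (1 + real (Suc C) * real m) < A * real m"
    by (rule eventually_linear_dominates_log[OF BA]) (simp_all add: S_def)
  then obtain m0 where m0: "\<And>m. m0 \<le> m \<Longrightarrow> B * (real m + 1) + S * ln (1 + real (Suc C) * real m) < A * real m"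
    unfolding eventually_sequentially by blast
  define D where "D = (2 * d) ^ b"
  have "2 * d \<le> D" unfolding D_def using b d self_le_power[of "2 * d" b] by simp
  then have D: "2 \<le> D" using d by simp
  have "\<exists>n\<in>SHF_sizes u q W. real q powr (2 - \<delta>) < n" if q: "D ^ m0 \<le> q" for q
  proof -
    have q1: "1 \<le> q" using q D one_le_power[of D m0] by linarith
    obtain m where m: "D ^ m \<le> q" "q < D ^ (m + 1)" using ex_power_ivl1[OF D q1] by blast
    have "D ^ m0 < D ^ (m + 1)" using q m(2) by linarith
    then have "m0 \<le> m" using D power_less_imp_less_exp[of D m0 "m + 1"] by simp
    have "(2 * d) ^ (m * b) \<le> q" using m(1) by (simp only: D_def power_mult[symmetric] mult.commute[of b m])
    then obtain n where n: "n \<in> SHF_sizes u q W" "d ^ (m * (a + b)) \<le> n * Suc (m * C) ^ ((2 * u) ^ u)"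
      using C W by blast
    have n0: "0 < n" using n(2) d by (cases n) auto
    have "A * real m = ln (real (d ^ (m * (a + b))))" using d by (simp add: ln_realpow A_def)
    also have "\<dots> \<le> ln (real (n * Suc (m * C) ^ ((2 * u) ^ u)))"
    proof -
      have pos: "0 < real (d ^ (m * (a + b)))" using d by simp
      have "real (d ^ (m * (a + b))) \<le> real (n * Suc (m * C) ^ ((2 * u) ^ u))"
        using n(2) by (rule of_nat_mono)
      then show ?thesis using pos by (rule ln_mono)
    qed
    also have "\<dots> = ln (real n) + S * ln (real (Suc (m * C)))"
      unfolding of_nat_mult of_nat_power S_def using n0 by (subst ln_mult) (simp_all add: ln_realpow del: of_nat_Suc)
    also have "\<dots> \<le> ln (real n) + S * ln (1 + real (Suc C) * real m)"
      by (intro add_left_mono mult_left_mono) (simp_all add: S_def algebra_simps add_pos_nonneg)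
    finally have "B * (real m + 1) < ln (real n)" using m0[OF \<open>m0 \<le> m\<close>] by linarith
    moreover have "(2 - \<delta>) * ln (real q) \<le> B * (real m + 1)"
    proof -
      have "ln (real q) \<le> ln (real (D ^ (m + 1)))" using m(2) q1 by (intro ln_mono of_nat_mono) simp_all
      also have "\<dots> = (real m + 1) * (real b * ln (real (2 * d)))"
      proof -
        have "ln (real (D ^ (m + 1))) = real (m + 1) * ln (real D)"
          unfolding of_nat_power by (rule ln_realpow)
        also have "ln (real D) = real b * ln (real (2 * d))"
          unfolding D_def of_nat_power by (rule ln_realpow)
        finally show ?thesis by simp
      qed
      finally have "(2 - \<delta>) * ln (real q) \<le> (2 - \<delta>) * ((real m + 1) * (real b * ln (real (2 * d))))"
        using \<delta> by (intro mult_left_mono) auto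
      then show ?thesis by (simp only: B_def mult_ac)
    qed
    ultimately have "(2 - \<delta>) * ln (real q) < ln (real n)" by linarith
    then have "exp ((2 - \<delta>) * ln (real q)) < exp (ln (real n))" by simp
    then have "real q powr (2 - \<delta>) < n" using q1 n0 by (simp add: powr_def)
    then show ?thesis using n(1) by blast
  qed
  then show ?thesis unfolding eventually_sequentially by blast
qed

text \<open>Instead of diagonalising over \<delta>, the exact deficit of the exponent is taken, cut
  off at 0; the summand \<open>1 / q\<close> makes the inequality strict.\<close>

lemma powr_lower_bound_o1:
  fixes M :: "nat \<Rightarrow> real" and c :: real
  assumes "\<And>\<delta>. 0 < \<delta> \<Longrightarrow> \<delta> \<le> 1 \<Longrightarrow> \<forall>\<^sub>F q in sequentially. real q powr (c - \<delta>) < M q"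
  shows "\<exists>\<epsilon> :: nat \<Rightarrow> real. \<epsilon> \<longlonglongrightarrow> 0 \<and> (\<forall>\<^sub>F q in sequentially. real q powr (c - \<epsilon> q) < M q)"
proof -
  define \<epsilon> where "\<epsilon> q = max 0 (c - ln (M q) / ln (real q)) + 1 / real q" for q
  have key: "\<forall>\<^sub>F q in sequentially. 1 < real q \<and> 0 < M q \<and> c - ln (M q) / ln (real q) < \<delta>"
    if \<delta>: "0 < \<delta>" "\<delta> \<le> 1" for \<delta>
    using assms[OF \<delta>] eventually_gt_at_top[of "1 :: nat"]
  proof eventually_elim
    case (elim q)
    have "0 \<le> real q powr (c - \<delta>)" by simp
    with elim(1) have M: "0 < M q" by linarith
    have lq: "0 < ln (real q)" using elim(2) by simp
    have "(c - \<delta>) * ln (real q) < ln (M q)"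
    proof -
      have "ln (real q powr (c - \<delta>)) < ln (M q)" using elim M by (subst ln_less_cancel_iff) auto
      then show ?thesis using elim(2) by (simp add: ln_powr)
    qed
    then have "c - \<delta> < ln (M q) / ln (real q)" using lq by (simp add: less_divide_eq)
    then show ?case using M elim(2) by simp
  qed
  have "\<epsilon> \<longlonglongrightarrow> 0 + 0"
    unfolding \<epsilon>_def
  proof (intro tendsto_add)
    show "(\<lambda>q. max 0 (c - ln (M q) / ln (real q))) \<longlonglongrightarrow> 0"
    proof (rule order_tendstoI)
      fix a :: real assume "a < 0"
      then show "\<forall>\<^sub>F q in sequentially. a < max 0 (c - ln (M q) / ln (real q))" by (simp add: less_max_iff_disj)
    next
      fix a :: real assume "0 < a"
      then have "\<forall>\<^sub>F q in sequentially. c - ln (M q) / ln (real q) < min a 1"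
        using key[of "min a 1"] by (auto elim: eventually_mono)
      then show "\<forall>\<^sub>F q in sequentially. max 0 (c - ln (M q) / ln (real q)) < a"
        using \<open>0 < a\<close> by (auto elim: eventually_mono)
    qed
    show "(\<lambda>q. 1 / real q) \<longlonglongrightarrow> 0" by real_asymp
  qed
  moreover have "\<forall>\<^sub>F q in sequentially. real q powr (c - \<epsilon> q) < M q"
    using key[of 1]
  proof (rule eventually_mono)
    fix q assume q: "1 < real q \<and> 0 < M q \<and> c - ln (M q) / ln (real q) < 1"
    have lq: "0 < ln (real q)" using q by simp
    have "0 < 1 / real q" using q by simp
    then have "c - \<epsilon> q < ln (M q) / ln (real q)" unfolding \<epsilon>_def by linarith
    then have "(c - \<epsilon> q) * ln (real q) < ln (M q)" using lq by (simp add: less_divide_eq)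
    then have "exp ((c - \<epsilon> q) * ln (real q)) < exp (ln (M q))" by simp
    then show "real q powr (c - \<epsilon> q) < M q" using q by (simp add: powr_def)
  qed simp_all
  ultimately show ?thesis by auto
qed

lemma max_SHF_asymptotics:
  fixes w :: "nat \<Rightarrow> nat"
  assumes t: "2 \<le> t" and w: "\<forall>i\<in>{1..t}. 1 \<le> w i" and excl: "t \<noteq> 2 \<or> min (w 1) (w 2) \<noteq> 1"
    and u: "u = (\<Sum>i=1..t. w i)" and W: "W = image_mset w (mset_set {1..t})"
  shows "\<exists>\<epsilon> :: nat \<Rightarrow> real. \<epsilon> \<longlonglongrightarrow> 0 \<and>
           (\<forall>\<^sub>F q in sequentially. real q powr (2 - \<epsilon> q) < real (max_SHF u q W))"
    and "(\<lambda>q. real (max_SHF u q W)) \<in> o(\<lambda>q. (real q)\<^sup>2)"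
proof -
  have "(\<Sum>i=1..t. 1) \<le> u" unfolding u using w by (intro sum_mono) auto
  then have u1: "1 \<le> u" using t by simp
  have sumW: "sum_mset W \<le> u" by (simp add: W u sum_unfold_sum_mset)
  have "size W \<ge> 2" "\<forall>w\<in>#W. w \<ge> 1" using t w by (auto simp: W)
  note fin = finite_SHF_sizes[OF this]
  \<comment> \<open>The maximum is attained, so a lower bound for one size and an upper bound for
    all sizes both carry over to it.\<close>
  have ge: "n \<le> max_SHF u q W" if "n \<in> SHF_sizes u q W" for n q
    unfolding max_SHF_def using fin that by (rule Max_ge)
  have mem: "max_SHF u q W \<in> SHF_sizes u q W" for q
    unfolding max_SHF_def using fin zero_in_SHF_sizes[OF u1] by (intro Max_in) blast+
  show "\<exists>\<epsilon> :: nat \<Rightarrow> real. \<epsilon> \<longlonglongrightarrow> 0 \<and>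
           (\<forall>\<^sub>F q in sequentially. real q powr (2 - \<epsilon> q) < real (max_SHF u q W))"
  proof (rule powr_lower_bound_o1)
    fix \<delta> :: real assume \<delta>: "0 < \<delta>" "\<delta> \<le> 1"
    show "\<forall>\<^sub>F q in sequentially. real q powr (2 - \<delta>) < real (max_SHF u q W)"
      using SHF_lower_bound[OF u1 \<delta> sumW]
    proof eventually_elim
      case (elim q)
      then obtain n where n: "n \<in> SHF_sizes u q W" "real q powr (2 - \<delta>) < n" by blast
      have "real n \<le> real (max_SHF u q W)" using ge[OF n(1)] by (rule of_nat_mono)
      with n(2) show ?case by (rule less_le_trans)
    qed
  qed
  show "(\<lambda>q. real (max_SHF u q W)) \<in> o(\<lambda>q. (real q)\<^sup>2)"
  proof (rule landau_o.smallI)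
    fix c :: real assume "0 < c"
    then obtain q0 where q0: "\<forall>q\<ge>q0. \<forall>n (F :: nat \<Rightarrow> nat \<Rightarrow> nat).
        separating_hash_family u {..<n} {..<q} W F \<longrightarrow> n \<le> c * (real q)\<^sup>2"
      using separating_small[OF t w excl u] unfolding W by blast
    have "norm (real (max_SHF u q W)) \<le> c * norm ((real q)\<^sup>2)" if "q0 \<le> q" for q
    proof -
      obtain F :: "nat \<Rightarrow> nat \<Rightarrow> nat" where "separating_hash_family u {..<max_SHF u q W} {..<q} W F"
        using mem[of q] unfolding SHF_sizes_def by blast
      then have "real (max_SHF u q W) \<le> c * (real q)\<^sup>2" using q0 that by blast
      then show ?thesis by simp
    qed
    then show "\<forall>\<^sub>F q in sequentially. norm (real (max_SHF u q W)) \<le> c * norm ((real q)\<^sup>2)"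
      unfolding eventually_sequentially by blast
  qed
qed

text \<open>The first part starts at \<open>t = 2\<close>: for a single set every size occurs by
  \<open>SHF_sizes_singleton\<close> as soon as \<open>q \<ge> 1\<close>, so no maximum exists. The
  second part is the case where all \<open>w i\<close> are 1.\<close>

theorem theorem3:
  "(\<forall>(t::nat) (w :: nat \<Rightarrow> nat).
      t \<ge> 2 \<longrightarrow> (\<forall>i\<in>{1..t}. w i \<ge> 1) \<longrightarrow> (t \<noteq> 2 \<or> min (w 1) (w 2) \<noteq> 1) \<longrightarrow>
      (let u = (\<Sum>i=1..t. w i); W = image_mset w (mset_set {1..t}) in
        (\<exists>\<epsilon> :: nat \<Rightarrow> real. \<epsilon> \<longlonglongrightarrow> 0 \<and>
           (\<forall>\<^sub>F q in sequentially. real q powr (2 - \<epsilon> q) < real (max_SHF u q W))) \<and>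
        (\<lambda>q. real (max_SHF u q W)) \<in> o(\<lambda>q. (real q)\<^sup>2))) \<and>
   (\<forall>t\<ge>3.
        (\<exists>\<epsilon> :: nat \<Rightarrow> real. \<epsilon> \<longlonglongrightarrow> 0 \<and>
           (\<forall>\<^sub>F q in sequentially. real q powr (2 - \<epsilon> q) < real (max_PHF t t q))) \<and>
        (\<lambda>q. real (max_PHF t t q)) \<in> o(\<lambda>q. (real q)\<^sup>2))"
proof (intro conjI allI impI)
  fix t :: nat and w :: "nat \<Rightarrow> nat"
  assume "t \<ge> 2" "\<forall>i\<in>{1..t}. w i \<ge> 1" "t \<noteq> 2 \<or> min (w 1) (w 2) \<noteq> 1"
  from max_SHF_asymptotics[OF this refl refl]
  show "let u = (\<Sum>i=1..t. w i); W = image_mset w (mset_set {1..t}) in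
        (\<exists>\<epsilon> :: nat \<Rightarrow> real. \<epsilon> \<longlonglongrightarrow> 0 \<and>
           (\<forall>\<^sub>F q in sequentially. real q powr (2 - \<epsilon> q) < real (max_SHF u q W))) \<and>
        (\<lambda>q. real (max_SHF u q W)) \<in> o(\<lambda>q. (real q)\<^sup>2)"
    unfolding Let_def by (rule conjI)
next
  fix t :: nat assume t: "3 \<le> t"
  then have "2 \<le> t" "\<forall>i\<in>{1..t}. 1 \<le> (1 :: nat)" "t \<noteq> 2 \<or> min 1 1 \<noteq> (1 :: nat)" by auto
  moreover have "t = (\<Sum>i=1..t. 1)" by simp
  moreover have "replicate_mset t 1 = image_mset (\<lambda>_. 1) (mset_set {1..t})"
    by (simp add: image_mset_const_eq)
  ultimately have *: "\<exists>\<epsilon> :: nat \<Rightarrow> real. \<epsilon> \<longlonglongrightarrow> 0 \<and>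
      (\<forall>\<^sub>F q in sequentially. real q powr (2 - \<epsilon> q) < real (max_SHF t q (replicate_mset t 1)))"
    "(\<lambda>q. real (max_SHF t q (replicate_mset t 1))) \<in> o(\<lambda>q. (real q)\<^sup>2)"
    by (rule max_SHF_asymptotics)+
  show "\<exists>\<epsilon> :: nat \<Rightarrow> real. \<epsilon> \<longlonglongrightarrow> 0 \<and>
      (\<forall>\<^sub>F q in sequentially. real q powr (2 - \<epsilon> q) < real (max_PHF t t q))"
    using *(1) unfolding max_PHF_def .
  show "(\<lambda>q. real (max_PHF t t q)) \<in> o(\<lambda>q. (real q)\<^sup>2)"
    using *(2) unfolding max_PHF_def .
qed

end
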